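(* There is a real number $r_0$ with decimal expansion $r_0=0.695356\ldots$ (i.e. $0.695356\le r_0<0.695357$) such that the following holds. Let $f$ be a holomorphic function in $\mathbb{D}$ with $f'(0)=1$ and let $B$ be a finite Blaschke product. Then the Bloch seminorm of $g=f\circ B$ satisfies $$\|g\|_{\mathbb{B}}\ge \frac{\sqrt3\,r_0}{4}=0.301098\ldots$$ Moreover, if additionally $f$ is a convex univalent function, then $$\|g\|_{\mathbb{B}}\ge \frac{\pi r_0}{4}=0.546131\ldots$$
   Context: $\mathbb{D}=\{z\in\mathbb{C}:|z|<1\}$. A finite Blaschke product is a function of the form $B(z)=\prod_{j=1}^n\frac{z-z_j}{1-\overline{z_j}z}$ with $|z_j|<1$, $n\ge 1$. For $g$ analytic in $\mathbb{D}$, its Bloch seminorm is $\|g\|_{\mathbb{B}}:=\sup_{z\in\mathbb{D}}|g'(z)|(1-|z|^2)$, which may be $+\infty$. A convex univalent function is an injective holomorphic function on $\mathbb{D}$ whose image is a convex set. *)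

theory Defs
  imports "HOL-Complex_Analysis.Complex_Analysis"
begin

text \<open>Values outside the open unit disc are irrelevant, so the product formula is only
  required on the disc. Degree at least one; no unimodular constant factor.\<close>
definition finite_blaschke_product :: "(complex \<Rightarrow> complex) \<Rightarrow> bool" where
  "finite_blaschke_product B \<longleftrightarrow>
     (\<exists>(n::nat) (a :: nat \<Rightarrow> complex). n \<ge> 1 \<and> (\<forall>j\<in>{1..n}. norm (a j) < 1) \<and>
        (\<forall>z\<in>ball 0 1. B z = (\<Prod>j=1..n. (z - a j) / (1 - cnj (a j) * z))))"

text \<open>Extended-real valued, since the supremum may be infinite.\<close>
definition bloch_seminorm :: "(complex \<Rightarrow> complex) \<Rightarrow> ereal" where
  "bloch_seminorm g = (SUP z\<in>ball 0 1. ereal (norm (deriv g z) * (1 - (norm z)\<^sup>2)))"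

definition convex_univalent :: "(complex \<Rightarrow> complex) \<Rightarrow> bool" where
  "convex_univalent f \<longleftrightarrow>
     f holomorphic_on ball 0 1 \<and> inj_on f (ball 0 1) \<and> convex (f ` ball 0 1)"

end

theory Submission
  imports Defs
begin

text \<open>
  Let \<open>F\<close> be a disc automorphism moving \<open>0\<close> to a regular value \<open>p\<close> of \<open>B\<close> close to \<open>0\<close>. From each of
  the \<open>N\<close> points of the fibre over \<open>p\<close>, lift \<open>F\<close> through \<open>B\<close> along rays from \<open>0\<close>; a ray is blocked only
  when its lift runs into a critical point, and a critical point of order \<open>m\<close> blocks at most
  \<open>m + 1 \<le> 2 m\<close> of the lifts. Since the orders of the critical points add up to \<open>N - 1\<close>, some point of the
  fibre has at most one blocked ray, so \<open>F\<close> lifts to the disc slit along a radius. By the Schwarz-Pick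
  inequality on this slit disc, the Bloch seminorm of \<open>f \<circ> B\<close> dominates \<open>\<bar>(f \<circ> F)'\<bar>\<close> times the conformal
  radius of the slit disc. For general \<open>f\<close> the maximum principle on the circle of radius \<open>1/2\<close> gives
  a bound arbitrarily close to \<open>1/2\<close>. For convex \<open>f\<close> one evaluates at the three points \<open>r u\<close>, \<open>r \<omega> u\<close>, \<open>r \<omega>\<^sup>2 u\<close>
  placed symmetrically opposite the slit and uses \<open>Re (1 + z f''/f') \<ge> 0\<close>; with \<open>r = 0.45\<close> this gives a
  bound near \<open>0.57\<close>. Both exceed the required constants.
\<close>

subsection \<open>Counting critical points\<close>

text \<open>The normalisation \<open>deriv f 0 = 1\<close> concerns the centre, but no lower bound
  is at hand for how far from 0 the remaining ray is blocked. So \<open>slit_disc u\<close> omits 0,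
  its conformal radius tends to 0 there, and every estimate is made away from 0 and carried back. At
  \<open>u * w\<close> with |w| = r the conformal radius is the modulus of 2 (1 - r) (w + r) / (1 +
  w), which is holomorphic in w with value 2 r (1 - r) at 0. This is largest at r = 1/2, with value
  1/2: hence the radius and the bound of the general case. In the convex case, averaging over three
  rotations leaves only powers of z^3, so the product of |h'| over the three points loses only the
  factor (1 + r^3)^2, against (1 + r)^6 from the distortion theorem applied pointwise. With the
  conformal radii this yields 4^(2/3) r (1 - r) / (1 + r^3) times |h'(0)|, nearly maximal at r =
  0.45. The value p is taken regular so that its fibre has N distinct points, and F injective so
  that a critical point can block lifts at one point of the disc only.\<close>

lemma finite_zeros_ball:
  fixes f :: "complex \<Rightarrow> complex"
  assumes f: "f holomorphic_on ball 0 R" and R: "r < R" and z: "z \<in> ball 0 R" "f z \<noteq> 0"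
  shows "finite {p \<in> ball 0 r. f p = 0}"
proof (cases "f constant_on ball 0 R")
  case True
  then have "{p \<in> ball 0 r. f p = 0} = {}"
    using z R unfolding constant_on_def by force
  then show ?thesis by (simp only: finite.emptyI)
next
  case False
  have "finite {p \<in> cball 0 r. f p = 0}"
    by (rule holomorphic_compact_finite_zeros[OF f open_ball connected_ball compact_cball _ False])
      (use R in auto)
  then show ?thesis by (rule rev_finite_subset) auto
qed

text \<open>Rouche's theorem counts zeros weighted by the winding number of the circle, which is 1
  inside and 0 outside; the strict inequality keeps zeros off the circle itself.\<close>

lemma Rouche_unit_disc:
  assumes f: "f holomorphic_on ball 0 R" and g: "g holomorphic_on ball 0 R" and R: "R > 1"
    and less: "\<And>z. norm z = 1 \<Longrightarrow> norm (g z) < norm (f z)"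
  shows "(\<Sum>p \<in> {p \<in> ball 0 1. f p + g p = 0}. zorder (\<lambda>p. f p + g p) p) =
         (\<Sum>p \<in> {p \<in> ball 0 1. f p = 0}. zorder f p)"
proof -
  \<comment> \<open>Zeros may accumulate at the boundary of \<open>ball 0 R\<close>; the disc of
    radius r < R contains finitely many.\<close>
  obtain r where r: "1 < r" "r < R" using R dense by blast
  have ne: "f z \<noteq> 0" "f z + g z \<noteq> 0" if "norm z = 1" for z
    using less[OF that] by (auto simp: add_eq_0_iff)
  have fin: "finite {p \<in> ball 0 r. f p = 0}" "finite {p \<in> ball 0 r. f p + g p = 0}"
    by (rule finite_zeros_ball[OF _ r(2), of _ 1]; use r ne[of 1] in \<open>auto intro: holomorphic_intros f g\<close>)+
  have wn: "winding_number (circlepath 0 1) p = (if norm p < 1 then 1 else 0)" if "norm p \<noteq> 1" for p :: complex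
  proof (cases "norm p < 1")
    case False
    then have "winding_number (circlepath 0 1) p = 0"
      using that by (intro winding_number_zero_outside[of _ "cball 0 1"]) auto
    then show ?thesis using False by simp
  qed (simp add: winding_number_circlepath)
  have "(\<Sum>p\<in>{p \<in> ball 0 r. f p + g p = 0}. winding_number (circlepath 0 1) p * zorder (\<lambda>p. f p + g p) p)
      = (\<Sum>p\<in>{p \<in> ball 0 r. f p = 0}. winding_number (circlepath 0 1) p * zorder f p)"
  proof (rule Rouche_theorem)
    show "\<forall>z. z \<notin> ball 0 r \<longrightarrow> winding_number (circlepath 0 1) z = 0"
      using wn r by (auto simp: not_less)
    show "f holomorphic_on ball 0 r" by (rule holomorphic_on_subset[OF f subset_ball]) (use r in simp)
    show "g holomorphic_on ball 0 r" by (rule holomorphic_on_subset[OF g subset_ball]) (use r in simp)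
    show "path_image (circlepath 0 1) \<subseteq> ball 0 r" using r by auto
  qed (use fin less in simp_all)
  moreover
  have "(\<Sum>p\<in>{p \<in> ball 0 r. h p = 0}. winding_number (circlepath 0 1) p * of_int (zorder h p))
      = of_int (\<Sum>p\<in>{p \<in> ball 0 1. h p = 0}. zorder h p)"
    if "finite {p \<in> ball 0 r. h p = 0}" "\<And>z. norm z = 1 \<Longrightarrow> h z \<noteq> 0" for h :: "complex \<Rightarrow> complex"
  proof -
    have "(\<Sum>p\<in>{p \<in> ball 0 r. h p = 0}. winding_number (circlepath 0 1) p * of_int (zorder h p))
       = (\<Sum>p\<in>{p \<in> ball 0 1. h p = 0}. winding_number (circlepath 0 1) p * of_int (zorder h p))"
      using that(1)
    proof (rule sum.mono_neutral_right)
      show "\<forall>p\<in>{p \<in> ball 0 r. h p = 0} - {p \<in> ball 0 1. h p = 0}.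
              winding_number (circlepath 0 1) p * of_int (zorder h p) = 0"
      proof
        fix p assume p: "p \<in> {p \<in> ball 0 r. h p = 0} - {p \<in> ball 0 1. h p = 0}"
        then have "norm p \<noteq> 1" using that(2) by auto
        with p wn show "winding_number (circlepath 0 1) p * of_int (zorder h p) = 0" by auto
      qed
    qed (use r in auto)
    also have "\<dots> = of_int (\<Sum>p\<in>{p \<in> ball 0 1. h p = 0}. zorder h p)"
      unfolding of_int_sum by (intro sum.cong) (auto simp: wn)
    finally show ?thesis .
  qed
  from this[of f] this[of "\<lambda>p. f p + g p"] fin ne
  have "(\<Sum>p\<in>{p \<in> ball 0 r. f p = 0}. winding_number (circlepath 0 1) p * of_int (zorder f p))
      = of_int (\<Sum>p\<in>{p \<in> ball 0 1. f p = 0}. zorder f p)"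
    "(\<Sum>p\<in>{p \<in> ball 0 r. f p + g p = 0}. winding_number (circlepath 0 1) p *
        of_int (zorder (\<lambda>p. f p + g p) p))
      = of_int (\<Sum>p\<in>{p \<in> ball 0 1. f p + g p = 0}. zorder (\<lambda>p. f p + g p) p)"
    by blast+
  ultimately show ?thesis by (simp only: of_int_eq_iff)
qed

text \<open>The order of \<open>b - b c\<close> at c is one more than that of
  \<open>deriv b\<close>, so it is that power of a function with a simple zero at c. Injectivity of
  this root \<open>h\<close> later bounds the number of lifts that run into c, since preimages near
  c are told apart by their roots.\<close>

lemma critical_power_form:
  assumes b: "b holomorphic_on S" "open S" "connected S" and c: "c \<in> S"
    and nz: "\<exists>z\<in>S. deriv b z \<noteq> 0"
  obtains h r where "r > 0" "inj_on h (ball c r)"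
    "\<And>z. z \<in> ball c r \<Longrightarrow> b z - b c = h z ^ Suc (nat (zorder (deriv b) c))"
proof -
  have b': "deriv b holomorphic_on S" using b by (simp add: holomorphic_deriv)
  have "\<exists>k. (deriv ^^ k) (deriv b) c \<noteq> 0"
    using holomorphic_fun_eq_0_on_connected[OF b' b(2,3), of c] c nz by blast
  then obtain k where k: "(deriv ^^ k) (deriv b) c \<noteq> 0" "\<And>i. i < k \<Longrightarrow> (deriv ^^ i) (deriv b) c = 0"
    using exists_least_iff[of "\<lambda>k. (deriv ^^ k) (deriv b) c \<noteq> 0"] by auto
  have ord: "zorder (deriv b) c = int k"
    by (rule zorder_zero_eqI[OF b' b(2) c]) (use k in auto)
  have shift: "(deriv ^^ Suc i) b c = (deriv ^^ i) (deriv b) c" for i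
    by (simp only: funpow_Suc_right o_apply)
  obtain g r where g: "0 < r" "g holomorphic_on ball c r"
    "\<And>w. w \<in> ball c r \<Longrightarrow> b w - b c = ((w - c) * g w) ^ Suc k"
    "\<And>w. w \<in> ball c r \<Longrightarrow> g w \<noteq> 0"
  proof (rule holomorphic_factor_order_of_zero_strong[OF b(1,2) c, of "Suc k"])
    show "(deriv ^^ Suc k) b c \<noteq> 0" using k(1) shift by simp
    show "(deriv ^^ i) b c = 0" if "0 < i" "i < Suc k" for i
      using k(2)[of "i - 1"] shift[of "i - 1"] that by simp
  qed auto
  define h where "h = (\<lambda>w. (w - c) * g w)"
  have h: "h holomorphic_on ball c r" unfolding h_def by (intro holomorphic_intros g)
  have "(g has_field_derivative deriv g c) (at c)"
    using g(1,2) by (auto intro: holomorphic_derivI)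
  from DERIV_mult[OF DERIV_diff[OF DERIV_ident DERIV_const, of c] this]
  have "deriv h c = g c" unfolding h_def by (intro DERIV_imp_deriv) simp
  then have "deriv h c \<noteq> 0" using g by simp
  then obtain s where s: "s > 0" "ball c s \<subseteq> ball c r" "inj_on h (ball c s)"
    using has_complex_derivative_locally_injective[OF h _ open_ball, of c] g(1) by auto
  show ?thesis
    by (rule that[OF s(1,3)]) (use s(2) g(3) ord h_def in auto)
qed

text \<open>The properties of a finite Blaschke product on which the counting rests.
  \<open>positive\<close> says z b'/b > 0 on the circle: b(z) moves strictly forward along the
  circle as z does.\<close>

locale circle_self_map =
  fixes b :: "complex \<Rightarrow> complex" and R :: real
  assumes R: "R > 1" and holo: "b holomorphic_on ball 0 R"
    and circle: "\<And>z. norm z = 1 \<Longrightarrow> norm (b z) = 1"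
    and positive: "\<And>z. norm z = 1 \<Longrightarrow> \<exists>\<kappa>>0. z * deriv b z = of_real \<kappa> * b z"
begin

definition crit :: "complex set" where "crit = {c \<in> ball 0 1. deriv b c = 0}"

lemma deriv_holo: "deriv b holomorphic_on ball 0 R"
  using holo by (simp add: holomorphic_deriv)

lemma deriv_circle_nonzero: "norm z = 1 \<Longrightarrow> deriv b z \<noteq> 0"
  using positive[of z] circle[of z] by fastforce

lemma finite_crit: "finite crit"
  unfolding crit_def using deriv_circle_nonzero[of 1] R
  by (intro finite_zeros_ball[OF deriv_holo R, of 1]) auto

lemma deriv_analytic: "z \<in> ball 0 1 \<Longrightarrow> deriv b analytic_on {z}"
  using R by (intro holomorphic_on_imp_analytic_at[OF deriv_holo]) auto

lemma eventually_deriv_nonzero: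
  assumes "z \<in> ball 0 1"
  shows "\<forall>\<^sub>F w in at z. deriv b w \<noteq> 0"
proof -
  have "\<forall>\<^sub>F w in at z. w \<in> ball 0 1 - (crit - {z})"
    using assms finite_crit by (intro eventually_at_in_open') (auto intro!: open_Diff finite_imp_closed)
  moreover have "\<forall>\<^sub>F w in at z. w \<noteq> z" by (simp add: eventually_at_filter)
  ultimately show ?thesis by eventually_elim (auto simp: crit_def)
qed

lemma crit_order_pos:
  assumes "c \<in> crit"
  shows "1 \<le> nat (zorder (deriv b) c)"
proof -
  have c: "c \<in> ball 0 1" "deriv b c = 0" using assms unfolding crit_def by auto
  have "\<exists>\<^sub>F w in at c. deriv b w \<noteq> 0"
    using eventually_deriv_nonzero[OF c(1)] by (intro eventually_frequently) auto
  then have "zorder (deriv b) c > 0"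
    using zorder_pos_iff'[OF deriv_analytic[OF c(1)]] c(2) by simp
  then show ?thesis by simp
qed

text \<open>A Riemann-Hurwitz count in terms of zero orders. Since |p| < 1 = |b| on the circle,
  \<open>b - p\<close> has as many zeros as \<open>b\<close>, say N, all simple by regularity. The
  function \<open>z * deriv b z\<close> has N zeros too, one of them due to the factor z.\<close>

lemma crit_count:
  assumes p: "norm p < 1" and reg: "\<And>z. z \<in> ball 0 1 \<Longrightarrow> b z = p \<Longrightarrow> deriv b z \<noteq> 0"
  shows "finite {z \<in> ball 0 1. b z = p}"
    and "(\<Sum>c\<in>crit. nat (zorder (deriv b) c)) < card {z \<in> ball 0 1. b z = p}"
proof -
  define N where "N = (\<Sum>z\<in>{z \<in> ball 0 1. b z = 0}. zorder b z)"
  have "b 1 \<noteq> p" using circle[of 1] p by auto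
  then show fin: "finite {z \<in> ball 0 1. b z = p}"
    using finite_zeros_ball[OF holomorphic_on_diff[OF holo holomorphic_on_const[of p]] R, of 1] R
    by simp
  have "(\<Sum>z\<in>{z \<in> ball 0 1. b z + - p = 0}. zorder (\<lambda>z. b z + - p) z) = N"
    unfolding N_def by (rule Rouche_unit_disc[OF holo _ R]) (use p circle in \<open>auto intro!: holomorphic_intros\<close>)
  moreover have "zorder (\<lambda>z. b z + - p) z = 1" if "z \<in> ball 0 1" "b z = p" for z
  proof (rule zorder_zero_eqI)
    show "(\<lambda>z. b z + - p) holomorphic_on ball 0 R" by (intro holomorphic_intros holo)
    have "deriv (\<lambda>z. b z + - p) z = deriv b z"
      using holo that(1) R by (subst deriv_add) (auto intro: holomorphic_on_imp_differentiable_at)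
    then show "(deriv ^^ nat 1) (\<lambda>z. b z + - p) z \<noteq> 0" using reg[OF that] by simp
  qed (use that R in auto)
  ultimately have card: "int (card {z \<in> ball 0 1. b z = p}) = N"
    by (simp add: add_eq_0_iff2)
  have "continuous_on (sphere 0 1) (\<lambda>z. norm (deriv b z))"
    using R by (intro continuous_on_norm
        holomorphic_on_imp_continuous_on[OF holomorphic_on_subset[OF deriv_holo]]) auto
  then obtain z0 where z0: "\<And>z. norm z = 1 \<Longrightarrow> norm (deriv b z) \<le> norm (deriv b z0)"
    using continuous_attains_sup[of "sphere 0 1" "\<lambda>z. norm (deriv b z)"]
    by (metis compact_sphere mem_sphere_0 norm_one empty_iff)
  \<comment> \<open>On the circle |b'| is the factor kappa of \<open>positive\<close>, so M exceeds
    every kappa and |kappa - M| < M.\<close>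
  define M where "M = norm (deriv b z0) + 1"
  have M: "M > 0" unfolding M_def by (simp add: add_nonneg_pos)
  \<comment> \<open>On the circle \<open>z b'\<close> is a positive multiple of \<open>b\<close>, so \<open>z b'\<close> and \<open>b\<close> have equally many zeros by Rouche.\<close>
  have less: "norm (z * deriv b z - M * b z) < norm (M * b z)" if z: "norm z = 1" for z
  proof -
    obtain \<kappa> where \<kappa>: "\<kappa> > 0" "z * deriv b z = of_real \<kappa> * b z" using positive[OF z] by auto
    then have "norm (z * deriv b z) = norm (of_real \<kappa> * b z)" by simp
    then have "norm (deriv b z) = \<kappa>" using z circle[OF z] \<kappa>(1) by (simp add: norm_mult)
    then have "\<kappa> < M" using z0[OF z] unfolding M_def by simp
    have "z * deriv b z - M * b z = of_real (\<kappa> - M) * b z" using \<kappa>(2) by (simp add: algebra_simps)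
    then have "norm (z * deriv b z - M * b z) = M - \<kappa>"
      using circle[OF z] \<open>\<kappa> < M\<close> by (simp only: norm_mult norm_of_real) simp
    then show ?thesis using \<kappa>(1) circle[OF z] M by (simp add: norm_mult)
  qed
  have "(\<Sum>z\<in>{z \<in> ball 0 1. M * b z + (z * deriv b z - M * b z) = 0}.
           zorder (\<lambda>z. M * b z + (z * deriv b z - M * b z)) z) =
        (\<Sum>z\<in>{z \<in> ball 0 1. M * b z = 0}. zorder (\<lambda>z. M * b z) z)"
    by (rule Rouche_unit_disc[OF _ _ R less]) (auto intro!: holomorphic_intros holo deriv_holo)
  also have "\<dots> = N" unfolding N_def using M by (intro sum.cong zorder_cmult) auto
  finally have sumN: "(\<Sum>z\<in>{z \<in> ball 0 1. z * deriv b z = 0}. zorder (\<lambda>z. z * deriv b z) z) = N"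
    by simp
  have set_eq: "{z \<in> ball 0 1. z * deriv b z = 0} = insert 0 crit" unfolding crit_def by auto
  have ord: "zorder (\<lambda>z. z * deriv b z) z = (if z = 0 then 1 else 0) + zorder (deriv b) z"
    if "z \<in> ball 0 1" for z
  proof -
    have "\<forall>\<^sub>F w in at z. w \<noteq> (0::complex)"
      by (rule eventually_neq_at_within)
    then have "\<forall>\<^sub>F w in at z. w * deriv b w \<noteq> 0"
      using eventually_deriv_nonzero[OF that] by eventually_elim auto
    then have "zorder (\<lambda>z. z * deriv b z) z = zorder (\<lambda>z. z) z + zorder (deriv b) z"
      using deriv_analytic[OF that] by (intro zorder_times_analytic) auto
    moreover have "zorder (\<lambda>z. z) z = (if z = 0 then 1 else 0)"
    proof (cases "z = 0")
      case True
      then show ?thesis using simple_zeroI[of UNIV 0 "\<lambda>_. 1" "\<lambda>z. z"] by simp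
    qed (simp add: zorder_eq_0I)
    ultimately show ?thesis by simp
  qed
  have nonneg: "zorder (deriv b) z \<ge> 0" if "z \<in> ball 0 1" for z
    using deriv_analytic[OF that] eventually_deriv_nonzero[OF that] by (intro zorder_ge_0 eventually_frequently) auto
  have "(\<Sum>z\<in>insert 0 crit. (if z = 0 then 1 else 0) + zorder (deriv b) z) = N"
    using sumN unfolding set_eq by (subst (asm) sum.cong[OF refl ord]) (auto simp: crit_def)
  then have "1 + (\<Sum>z\<in>insert 0 crit. zorder (deriv b) z) = N"
    using finite_crit by (simp add: sum.distrib)
  \<comment> \<open>The point 0 may or may not be critical; adjoining it adds a nonnegative
    order.\<close>
  moreover have "(\<Sum>z\<in>crit. zorder (deriv b) z) \<le> (\<Sum>z\<in>insert 0 crit. zorder (deriv b) z)"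
    using finite_crit nonneg by (intro sum_mono2) auto
  moreover have "int (\<Sum>c\<in>crit. nat (zorder (deriv b) c)) = (\<Sum>z\<in>crit. zorder (deriv b) z)"
    unfolding of_nat_sum using nonneg by (intro sum.cong) (auto simp: crit_def)
  ultimately show "(\<Sum>c\<in>crit. nat (zorder (deriv b) c)) < card {z \<in> ball 0 1. b z = p}"
    using card by linarith
qed

lemma crit_power_form:
  assumes "c \<in> ball 0 1"
  shows "\<exists>h r. r > 0 \<and> inj_on h (ball c r) \<and>
     (\<forall>z\<in>ball c r. b z - b c = h z ^ Suc (nat (zorder (deriv b) c)))"
proof -
  have "c \<in> ball 0 R" using assms R by auto
  moreover have "\<exists>z\<in>ball 0 R. deriv b z \<noteq> 0"
    using deriv_circle_nonzero[of 1] R by (intro bexI[of _ 1]) auto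
  ultimately show ?thesis
  proof (rule critical_power_form[OF holo open_ball connected_ball])
    fix h r
    assume "r > 0" "inj_on h (ball c r)"
      "\<And>z. z \<in> ball c r \<Longrightarrow> b z - b c = h z ^ Suc (nat (zorder (deriv b) c))"
    then show ?thesis by (intro exI[of _ h] exI[of _ r]) simp
  qed
qed

text \<open>The sublevel set in the closed disc is compact and misses the circle, where |b| = 1.
  This is what will confine lifts to a compact part of the disc.\<close>

lemma proper:
  assumes "\<rho> < 1"
  shows "\<exists>\<rho>'<1. \<forall>z\<in>ball 0 1. norm (b z) \<le> \<rho> \<longrightarrow> norm z \<le> \<rho>'"
proof (cases "{z \<in> cball 0 1. norm (b z) \<le> \<rho>} = {}")
  case True
  then show ?thesis by (intro exI[of _ 0]) (auto simp: subset_iff)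
next
  case False
  let ?K = "{z \<in> cball 0 1. norm (b z) \<le> \<rho>}"
  have cont: "continuous_on (cball 0 1) (\<lambda>z. norm (b z))"
    using R by (intro continuous_on_norm
        holomorphic_on_imp_continuous_on[OF holomorphic_on_subset[OF holo]]) auto
  have "closed (cball 0 1 \<inter> (\<lambda>z. norm (b z)) -` {..\<rho>})"
    by (rule continuous_closed_preimage[OF cont]) auto
  moreover have "?K = cball 0 1 \<inter> (\<lambda>z. norm (b z)) -` {..\<rho>}" by auto
  ultimately have "closed ?K" by simp
  moreover have "bounded ?K" by (rule bounded_subset[OF bounded_cball[of 0 1]]) auto
  ultimately have "compact ?K" by (simp add: compact_eq_bounded_closed)
  then obtain x where x: "x \<in> ?K" "\<And>z. z \<in> ?K \<Longrightarrow> norm z \<le> norm x"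
    using continuous_attains_sup[of ?K norm] False by (auto intro: continuous_intros)
  have "norm x \<noteq> 1" using x(1) circle[of x] assms by auto
  then have "norm x < 1" using x(1) by auto
  then show ?thesis using x(2) by (intro exI[of _ "norm x"]) auto
qed

end

section \<open>Finite Blaschke products on the unit circle and slightly beyond it\<close>

lemma blaschke_factor_circle:
  assumes a: "norm a < 1" and z: "norm z = 1"
  defines "\<phi> \<equiv> \<lambda>z. (z - a) / (1 - cnj a * z)"
  shows "norm (\<phi> z) = 1"
    and "\<exists>D \<kappa>. (\<phi> has_field_derivative D) (at z) \<and> \<kappa> > 0 \<and> z * D = of_real \<kappa> * \<phi> z"
proof -
  have zz: "z * cnj z = 1" using z by (simp add: complex_norm_square[symmetric])
  \<comment> \<open>On the circle the denominator is z times the conjugate of the numerator; both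
    the modulus and the derivative formula come from this.\<close>
  have den: "1 - cnj a * z = z * cnj (z - a)"
    using zz by (simp add: algebra_simps)
  have za: "z \<noteq> a" and z0: "z \<noteq> 0" using a z by auto
  have den0: "1 - cnj a * z \<noteq> 0" unfolding den using za z0 by simp
  show "norm (\<phi> z) = 1"
    unfolding \<phi>_def den using za z by (simp add: norm_divide norm_mult flip: complex_cnj_diff)
  define D where "D = (1 * (1 - cnj a * z) - (z - a) * (0 - cnj a * 1)) / ((1 - cnj a * z) * (1 - cnj a * z))"
  have D: "(\<phi> has_field_derivative D) (at z)"
    unfolding \<phi>_def D_def by (rule derivative_eq_intros refl den0 | simp)+
  \<comment> \<open>The Poisson kernel of the disc for the point a: the logarithmic derivative z D /
    phi of the factor on the circle.\<close>
  define \<kappa> where "\<kappa> = (1 - (norm a)\<^sup>2) / (norm (z - a))\<^sup>2"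
  have "\<kappa> > 0" unfolding \<kappa>_def using a za by (simp add: abs_square_less_1)
  moreover have "z * D = of_real \<kappa> * \<phi> z"
  proof -
    have "D = (1 - of_real ((norm a)\<^sup>2)) / ((1 - cnj a * z) * (1 - cnj a * z))"
      unfolding D_def complex_norm_square by (simp add: algebra_simps)
    then have "z * D = z * (1 - of_real ((norm a)\<^sup>2)) / ((z * cnj (z - a)) * (1 - cnj a * z))"
      by (simp add: den)
    also have "\<dots> = (1 - of_real ((norm a)\<^sup>2)) / (cnj (z - a) * (1 - cnj a * z))"
      using z0 by simp
    also have "\<dots> = (1 - of_real ((norm a)\<^sup>2)) / ((z - a) * cnj (z - a)) * ((z - a) / (1 - cnj a * z))"
      using za by simp
    also have "(1 - of_real ((norm a)\<^sup>2)) / ((z - a) * cnj (z - a)) = of_real \<kappa>"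
      unfolding \<kappa>_def complex_norm_square[symmetric] by simp
    finally show ?thesis unfolding \<phi>_def .
  qed
  ultimately show "\<exists>D \<kappa>. (\<phi> has_field_derivative D) (at z) \<and> \<kappa> > 0 \<and> z * D = of_real \<kappa> * \<phi> z"
    using D by blast
qed

definition blaschke_product :: "nat \<Rightarrow> (nat \<Rightarrow> complex) \<Rightarrow> complex \<Rightarrow> complex" where
  "blaschke_product n a z = (\<Prod>j=1..n. (z - a j) / (1 - cnj (a j) * z))"

text \<open>The numbers kappa are logarithmic derivatives and add up over the factors; the empty
  product starts the induction with kappa = 0, hence the case distinction.\<close>

lemma blaschke_product_circle:
  assumes a: "\<forall>j\<in>{1..n}. norm (a j) < 1" and z: "norm z = 1"
  shows "norm (blaschke_product n a z) = 1"
    and "\<exists>D \<kappa>. (blaschke_product n a has_field_derivative D) (at z) \<and>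
      (if n = 0 then \<kappa> = 0 else \<kappa> > 0) \<and> z * D = of_real \<kappa> * blaschke_product n a z"
  using a
proof (induction n)
  case 0
  case 2
  have "blaschke_product 0 a = (\<lambda>_. 1)" by (auto simp: blaschke_product_def)
  then show ?case by (intro exI[of _ 0]) auto
next
  case (Suc n)
  let ?\<phi> = "\<lambda>z. (z - a (Suc n)) / (1 - cnj (a (Suc n)) * z)"
  have eq: "blaschke_product (Suc n) a = (\<lambda>z. blaschke_product n a z * ?\<phi> z)"
    by (auto simp: blaschke_product_def)
  {
    case 1
    then have "norm (blaschke_product n a z) = 1" "norm (?\<phi> z) = 1"
      using Suc.IH(1) blaschke_factor_circle(1)[of "a (Suc n)", OF _ z] by auto
    then show ?case by (simp only: eq norm_mult mult_1)
  next
    case 2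
    then obtain D \<kappa> where D: "(blaschke_product n a has_field_derivative D) (at z)"
      "if n = 0 then \<kappa> = 0 else \<kappa> > 0" "z * D = of_real \<kappa> * blaschke_product n a z"
      using Suc.IH(2) by auto
    obtain D' \<kappa>' where D': "(?\<phi> has_field_derivative D') (at z)" "\<kappa>' > 0" "z * D' = of_real \<kappa>' * ?\<phi> z"
      using blaschke_factor_circle(2)[of "a (Suc n)", OF _ z] 2 by auto
    have pos: "\<kappa> + \<kappa>' > 0" using D(2) D'(2) by (cases "n = 0") auto
    have "z * (D * ?\<phi> z + D' * blaschke_product n a z) =
        (z * D) * ?\<phi> z + (z * D') * blaschke_product n a z" by (simp add: distrib_left mult.assoc)
    also have "\<dots> = of_real (\<kappa> + \<kappa>') * blaschke_product (Suc n) a z"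
      unfolding D(3) D'(3) by (simp add: eq add_divide_distrib distrib_left distrib_right mult.commute mult.left_commute)
    finally have rel: "z * (D * ?\<phi> z + D' * blaschke_product n a z) =
        of_real (\<kappa> + \<kappa>') * blaschke_product (Suc n) a z" .
    have "(blaschke_product (Suc n) a has_field_derivative
        (D * ?\<phi> z + D' * blaschke_product n a z)) (at z)"
      unfolding eq by (rule DERIV_mult[OF D(1) D'(1)])
    with rel pos show ?case
      by (intro exI[of _ "D * ?\<phi> z + D' * blaschke_product n a z"] exI[of _ "\<kappa> + \<kappa>'"]) simp
  }
qed (simp add: blaschke_product_def)

lemma blaschke_product_circle_self_map:
  assumes n: "n \<ge> 1" and a: "\<forall>j\<in>{1..n}. norm (a j) < 1"
  obtains R where "circle_self_map (blaschke_product n a) R"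
proof -
  define \<rho> where "\<rho> = Max ((\<lambda>j. norm (a j)) ` {1..n})"
  have \<rho>: "norm (a j) \<le> \<rho>" if "j \<in> {1..n}" for j unfolding \<rho>_def using that by (intro Max_ge) auto
  have \<rho>1: "\<rho> < 1" unfolding \<rho>_def using n a by (subst Max_less_iff) auto
  have \<rho>0: "0 \<le> \<rho>" using \<rho>[of 1] n norm_ge_zero[of "a 1"] by (meson atLeastAtMost_iff order_refl order_trans)
  \<comment> \<open>Chosen so that rho R < 1 < R: the disc of radius R reaches past the circle but
    contains no pole.\<close>
  define R where "R = 2 / (1 + \<rho>)"
  have R: "R > 1" "\<rho> * R < 1" unfolding R_def using \<rho>0 \<rho>1 by (auto simp: field_simps)
  have nz: "1 - cnj (a j) * z \<noteq> 0" if "j \<in> {1..n}" "z \<in> ball 0 R" for j z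
  proof
    assume "1 - cnj (a j) * z = 0"
    then have "norm (cnj (a j) * z) = norm (1::complex)" by (metis eq_iff_diff_eq_0)
    moreover have "norm (a j) * norm z \<le> \<rho> * R" using \<rho>[OF that(1)] that(2) \<rho>0 by (intro mult_mono) auto
    ultimately show False using R(2) by (simp add: norm_mult)
  qed
  have "circle_self_map (blaschke_product n a) R"
  proof
    show "blaschke_product n a holomorphic_on ball 0 R"
      unfolding blaschke_product_def using nz by (intro holomorphic_intros) auto
    show "norm (blaschke_product n a z) = 1" if "norm z = 1" for z
      by (rule blaschke_product_circle(1)[OF a that])
    show "\<exists>\<kappa>>0. z * deriv (blaschke_product n a) z = of_real \<kappa> * blaschke_product n a z"
      if z: "norm z = 1" for z
    proof -
      obtain D \<kappa> where "(blaschke_product n a has_field_derivative D) (at z)" "\<kappa> > 0"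
        "z * D = of_real \<kappa> * blaschke_product n a z"
        using blaschke_product_circle(2)[OF a z] n by auto
      then show ?thesis by (auto dest: DERIV_imp_deriv)
    qed
  qed (rule R)
  then show ?thesis using that by blast
qed

subsection \<open>Schwarz-Pick on a slit disc\<close>

text \<open>The value s = 0 is included, so the centre is removed as well. The result is the image
  of the open right half disc under s -> u s^2, which makes its conformal maps explicit.\<close>

definition slit_disc :: "complex \<Rightarrow> complex set" where
  "slit_disc u = ball 0 1 - {- of_real s * u |s. s \<ge> 0}"

text \<open>Conformal radius of \<open>slit_disc u\<close> at \<open>u * s\<^sup>2\<close>, where \<open>s\<close> lies in the right half disc.\<close>

definition slit_radius :: "complex \<Rightarrow> real" where
  "slit_radius s = 4 * norm s * Re s * (1 - (norm s)\<^sup>2) / norm (1 + s\<^sup>2)"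

text \<open>The Schwarz lemma for H followed by the automorphism that takes \<open>H 0\<close> to 0.
  The base point 0 suffices, as the conformal map of the slit disc moves the other points
  there.\<close>

lemma Schwarz_Pick_at_0:
  assumes H: "H holomorphic_on ball 0 1" and lt: "\<And>z. norm z < 1 \<Longrightarrow> norm (H z) < 1"
  shows "norm (deriv H 0) \<le> 1 - (norm (H 0))\<^sup>2"
proof -
  define w where "w = H 0"
  have w: "norm w < 1" unfolding w_def by (rule lt) simp
  let ?M = "Moebius_function 0 w"
  have M: "?M holomorphic_on ball 0 1" by (rule Moebius_function_holomorphic[OF w])
  have "?M \<circ> H holomorphic_on ball 0 1"
    by (rule holomorphic_on_compose_gen[OF H M]) (use lt in auto)
  moreover have "(?M \<circ> H) 0 = 0" unfolding o_def w_def[symmetric] by (rule Moebius_function_eq_zero)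
  moreover have "norm ((?M \<circ> H) z) < 1" if "norm z < 1" for z
    unfolding o_def by (rule Moebius_function_norm_lt_1[OF w lt[OF that]])
  ultimately have le: "norm (deriv (?M \<circ> H) 0) \<le> 1" using Schwarz_Lemma(2)[of "?M \<circ> H" 0] by auto
  have nz: "1 - cnj w * w = of_real (1 - (norm w)\<^sup>2)"
    unfolding of_real_diff complex_norm_square by (simp add: mult.commute)
  have pos: "1 - (norm w)\<^sup>2 > 0" using w by (simp add: abs_square_less_1)
  then have nz0: "1 - cnj w * w \<noteq> 0" unfolding nz by (simp only: of_real_eq_0_iff)
  have "(?M has_field_derivative (1 * (1 - cnj w * w) - (w - w) * (0 - cnj w * 1)) /
      ((1 - cnj w * w) * (1 - cnj w * w))) (at w)"
    unfolding Moebius_function_simple by (rule derivative_eq_intros refl nz0 | simp)+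
  then have "deriv ?M w = 1 / (1 - cnj w * w)" using nz0 by (simp add: DERIV_imp_deriv)
  moreover have "deriv (?M \<circ> H) 0 = deriv ?M (H 0) * deriv H 0"
    by (rule deriv_chain)
      (use H M w in \<open>auto intro: holomorphic_on_imp_differentiable_at simp: w_def\<close>)
  ultimately have "norm (deriv H 0) / norm (1 - cnj w * w) \<le> 1"
    using le by (simp add: norm_mult norm_divide w_def)
  moreover have "norm (1 - cnj w * w) = 1 - (norm w)\<^sup>2"
    unfolding nz norm_of_real using pos by simp
  ultimately show ?thesis using pos by (simp add: w_def)
qed

lemma mem_slit_disc:
  assumes "norm u = 1" "Re s > 0" "norm s < 1"
  shows "u * s\<^sup>2 \<in> slit_disc u"
proof -
  have "norm (u * s\<^sup>2) < 1"
    using assms by (simp add: norm_mult norm_power abs_square_less_1)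
  moreover have "u * s\<^sup>2 \<noteq> - of_real t * u" if "t \<ge> 0" for t
  proof
    assume "u * s\<^sup>2 = - of_real t * u"
    then have "u * s\<^sup>2 = u * (- of_real t)" by simp
    then have "s\<^sup>2 = - of_real t" using assms(1) unfolding mult_cancel_left by auto
    then have "Im (s\<^sup>2) = 0" "Re (s\<^sup>2) = - t" by auto
    then have "2 * Re s * Im s = 0" "(Re s)\<^sup>2 - (Im s)\<^sup>2 = - t"
      by (simp_all only: Im_power2 Re_power2)
    then have "(Re s)\<^sup>2 \<le> 0" using assms(2) that by simp
    then show False using assms(2) by simp
  qed
  ultimately show ?thesis unfolding slit_disc_def by auto
qed

text \<open>This inverts s -> 1/s - s, which maps the open right half disc onto the right
  half-plane. With t = 1/s the other root of the quadratic is -t; the principal square root gives Re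
  t > 0, and Re t - Re s = Re p > 0 forces |s| < 1.\<close>

lemma half_disc_root:
  assumes p: "Re p > 0"
  defines "s \<equiv> (csqrt (p\<^sup>2 + 4) - p) / 2"
  shows "Re s > 0" "norm s < 1" "s\<^sup>2 + p * s = 1"
proof -
  define q where "q = csqrt (p\<^sup>2 + 4)"
  have q: "Re q \<ge> 0" "q\<^sup>2 = p\<^sup>2 + 4" using csqrt_principal[of "p\<^sup>2 + 4"] unfolding q_def by auto
  have s_def: "s = (q - p) / 2" unfolding s_def q_def ..
  define t where "t = (q + p) / 2"
  have t: "Re t > 0" unfolding t_def using p q(1) by simp
  have "s * t = (q\<^sup>2 - p\<^sup>2) / 4" unfolding s_def t_def by (simp add: power2_eq_square algebra_simps)
  then have st: "s * t = 1" using q(2) by simp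
  then have s: "s = inverse t" by (metis inverse_unique mult.commute)
  then show pos: "Re s > 0" using t by (simp add: add_nonneg_eq_0_iff add_pos_nonneg)
  have "t - s = p" unfolding t_def s_def by (simp add: field_simps)
  then show "s\<^sup>2 + p * s = 1" using st by (auto simp: power2_eq_square algebra_simps)
  have "Re t - Re s = Re p" using \<open>t - s = p\<close> by (metis minus_complex.sel(1))
  moreover have "Re t = Re s / (norm s)\<^sup>2"
    using st by (metis inverse_unique mult.commute Re_divide cmod_power2 inverse_complex.sel(1))
  ultimately have "Re s < Re s / (norm s)\<^sup>2" using p by simp
  moreover have "(norm s)\<^sup>2 > 0" using pos by auto
  ultimately have "Re s * (norm s)\<^sup>2 < Re s * 1" by (simp add: field_simps)
  then have "(norm s)\<^sup>2 < 1" using pos by (simp only: mult_less_cancel_left_pos)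
  then show "norm s < 1" by (simp add: abs_square_less_1)
qed

lemma slit_disc_conformal_radius:
  assumes u: "norm u = 1" and s: "Re s > 0" "norm s < 1"
  obtains \<psi> where "\<psi> holomorphic_on ball 0 1" "\<psi> ` ball 0 1 \<subseteq> slit_disc u" "\<psi> 0 = u * s\<^sup>2"
    "norm (deriv \<psi> 0) = slit_radius s"
proof -
  have s0: "s \<noteq> 0" using s by auto
  define p where "p = 1 / s - s"
  have Rep: "Re p * (norm s)\<^sup>2 = Re s * (1 - (norm s)\<^sup>2)"
  proof -
    have "Re (1 / s) = Re s / (norm s)\<^sup>2" by (simp add: Re_divide cmod_power2)
    then have "Re p = Re s / (norm s)\<^sup>2 - Re s" unfolding p_def by simp
    then show ?thesis using s0 by (simp add: field_simps)
  qed
  have "(norm s)\<^sup>2 < 1" using s by (simp add: abs_square_less_1)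
  then have "Re p * (norm s)\<^sup>2 > 0" unfolding Rep using s by simp
  then have p: "Re p > 0" using s0 by (simp add: zero_less_mult_iff)
  \<comment> \<open>A conformal map of the disc onto the right half-plane with P(0) = p and P'(0) =
    2 Re p. Solving s^2 + P s = 1 leads on to the right half disc, and squaring opens that to the
    slit disc.\<close>
  define P where "P = (\<lambda>z. (p + cnj p * z) / (1 - z))"
  have P_pos: "Re (P z) > 0" if "norm z < 1" for z
  proof -
    have "1 - z \<noteq> 0" using that by auto
    have "P z = (p + cnj p * z) * cnj (1 - z) / (of_real ((norm (1 - z))\<^sup>2))"
      unfolding P_def by (subst complex_div_cnj) simp
    moreover have "Re ((p + cnj p * z) * cnj (1 - z)) = Re p * (1 - (norm z)\<^sup>2)"
      unfolding cmod_power2 by (simp add: algebra_simps power2_eq_square)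
    ultimately have "Re (P z) = Re p * (1 - (norm z)\<^sup>2) / (norm (1 - z))\<^sup>2"
      by (simp only: Re_divide_of_real)
    moreover have "(norm z)\<^sup>2 < 1" using that by (simp add: abs_square_less_1)
    ultimately show ?thesis using p \<open>1 - z \<noteq> 0\<close> by simp
  qed
  define S where "S = (\<lambda>z. (csqrt ((P z)\<^sup>2 + 4) - P z) / 2)"
  have S: "Re (S z) > 0" "norm (S z) < 1" "(S z)\<^sup>2 + P z * S z = 1" if "norm z < 1" for z
    using half_disc_root[OF P_pos[OF that]] unfolding S_def by auto
  have notneg: "(P z)\<^sup>2 + 4 \<notin> \<real>\<^sub>\<le>\<^sub>0" if "norm z < 1" for z
  proof
    assume "(P z)\<^sup>2 + 4 \<in> \<real>\<^sub>\<le>\<^sub>0"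
    then have *: "Im ((P z)\<^sup>2 + 4) = 0" "Re ((P z)\<^sup>2 + 4) \<le> 0" by (auto simp: complex_nonpos_Reals_iff)
    then have "2 * Re (P z) * Im (P z) = 0" by (simp add: Im_power2)
    then have "Im (P z) = 0" using P_pos[OF that] by auto
    then have "(Re (P z))\<^sup>2 + 4 \<le> 0" using *(2) by (simp add: Re_power2)
    then show False using zero_le_power2[of "Re (P z)"] by linarith
  qed
  have P_holo: "P holomorphic_on ball 0 1" unfolding P_def by (intro holomorphic_intros) auto
  have S_holo: "S holomorphic_on ball 0 1"
    unfolding S_def by (intro holomorphic_intros P_holo) (use notneg in auto)
  have "P 0 = p" unfolding P_def by simp
  moreover have "csqrt (p\<^sup>2 + 4) = 1 / s + s"
  proof -
    have "p\<^sup>2 + 4 = (1 / s + s)\<^sup>2" unfolding p_def using s0 by (simp add: power2_eq_square field_simps)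
    moreover have "Re (1 / s) > 0" using s s0 by (simp add: Re_divide sum_power2_gt_zero_iff complex_eq_iff)
    ultimately show ?thesis using s by (simp add: csqrt_square)
  qed
  ultimately have S0: "S 0 = s" unfolding S_def p_def by simp
  have P': "(P has_field_derivative 2 * of_real (Re p)) (at 0)"
  proof -
    have "(P has_field_derivative (cnj p * (1 - 0) - (p + cnj p * 0) * (0 - 1)) / ((1 - 0) * (1 - 0))) (at 0)"
      unfolding P_def by (rule derivative_eq_intros refl | simp)+
    moreover have "cnj p + p = 2 * of_real (Re p)" by (simp add: complex_eq_iff)
    ultimately show ?thesis by (simp add: add.commute)
  qed
  have S': "(S has_field_derivative deriv S 0) (at 0)"
    using S_holo by (auto intro: holomorphic_derivI)
  \<comment> \<open>Implicit differentiation of S^2 + P S = 1 avoids differentiating the square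
    root.\<close>
  have "((\<lambda>z. (S z)\<^sup>2 + P z * S z) has_field_derivative
      (of_nat 2 * (deriv S 0 * S 0 ^ (2 - Suc 0)) + (2 * of_real (Re p) * S 0 + deriv S 0 * P 0))) (at 0)"
    by (intro DERIV_add DERIV_mult DERIV_power P' S')
  moreover have "((\<lambda>z. (S z)\<^sup>2 + P z * S z) has_field_derivative 0) (at 0)"
    by (rule has_field_derivative_transform_within_open[of "\<lambda>_. 1" _ _ "ball 0 1"]) (use S(3) in auto)
  ultimately have "2 * (deriv S 0 * s) + (2 * of_real (Re p) * s + deriv S 0 * p) = 0"
    using DERIV_unique[of "\<lambda>z. (S z)\<^sup>2 + P z * S z" _ 0 0] \<open>P 0 = p\<close> by (simp add: S0)
  then have "(deriv S 0 * (1 + s\<^sup>2)) / s + 2 * of_real (Re p) * s = 0"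
    unfolding p_def using s0 by (simp add: field_simps power2_eq_square)
  then have "deriv S 0 * (1 + s\<^sup>2) + 2 * of_real (Re p) * s\<^sup>2 = 0"
    using s0 by (simp add: field_simps power2_eq_square)
  then have eq: "deriv S 0 * (1 + s\<^sup>2) = - 2 * of_real (Re p) * s\<^sup>2"
    by (simp add: eq_neg_iff_add_eq_0)
  define \<psi> where "\<psi> = (\<lambda>z. u * (S z)\<^sup>2)"
  have "(\<psi> has_field_derivative (u * (of_nat 2 * (deriv S 0 * S 0 ^ (2 - Suc 0))))) (at 0)"
    unfolding \<psi>_def by (intro DERIV_cmult DERIV_power S')
  then have d: "deriv \<psi> 0 = 2 * u * s * deriv S 0" by (simp add: DERIV_imp_deriv S0)
  have nz: "norm (1 + s\<^sup>2) > 0"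
  proof -
    have "norm (s\<^sup>2) < 1" using s by (simp add: norm_power abs_square_less_1)
    then show ?thesis by (metis add_eq_0_iff less_irrefl norm_minus_cancel norm_one zero_less_norm_iff)
  qed
  have "norm (deriv S 0 * (1 + s\<^sup>2)) = 2 * Re p * (norm s)\<^sup>2"
    unfolding eq using p by (simp add: norm_mult norm_power)
  then have "norm (deriv S 0) = 2 * (Re p * (norm s)\<^sup>2) / norm (1 + s\<^sup>2)"
    using nz unfolding norm_mult by (simp add: eq_divide_eq)
  then have "norm (deriv \<psi> 0) = slit_radius s"
    unfolding d Rep slit_radius_def by (simp add: norm_mult u mult.assoc)
  moreover have "\<psi> holomorphic_on ball 0 1" unfolding \<psi>_def by (intro holomorphic_intros S_holo)
  moreover have "\<psi> ` ball 0 1 \<subseteq> slit_disc u"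
    unfolding \<psi>_def using S(1,2) by (auto intro!: mem_slit_disc[OF u])
  moreover have "\<psi> 0 = u * s\<^sup>2" unfolding \<psi>_def S0 ..
  ultimately show ?thesis using that by blast
qed

lemma Schwarz_Pick_slit_disc:
  assumes u: "norm u = 1" and s: "Re s > 0" "norm s < 1"
    and G: "G holomorphic_on slit_disc u" "G ` slit_disc u \<subseteq> ball 0 1" "open (slit_disc u)"
  shows "norm (deriv G (u * s\<^sup>2)) * slit_radius s \<le> 1 - (norm (G (u * s\<^sup>2)))\<^sup>2"
proof -
  obtain \<psi> where \<psi>: "\<psi> holomorphic_on ball 0 1" "\<psi> ` ball 0 1 \<subseteq> slit_disc u" "\<psi> 0 = u * s\<^sup>2"
    "norm (deriv \<psi> 0) = slit_radius s"
    using slit_disc_conformal_radius[OF u s] .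
  have "G \<circ> \<psi> holomorphic_on ball 0 1"
    by (rule holomorphic_on_compose_gen[OF \<psi>(1) G(1) \<psi>(2)])
  moreover have "norm ((G \<circ> \<psi>) z) < 1" if "norm z < 1" for z
    using that \<psi>(2) G(2) by (auto simp: image_subset_iff)
  ultimately have "norm (deriv (G \<circ> \<psi>) 0) \<le> 1 - (norm ((G \<circ> \<psi>) 0))\<^sup>2"
    by (rule Schwarz_Pick_at_0)
  moreover have "deriv (G \<circ> \<psi>) 0 = deriv G (\<psi> 0) * deriv \<psi> 0"
  proof (rule deriv_chain)
    show "\<psi> field_differentiable at 0"
      using \<psi>(1) by (auto intro: holomorphic_on_imp_differentiable_at)
    show "G field_differentiable at (\<psi> 0)"
      using \<psi>(3) mem_slit_disc[OF u s] by (auto intro: holomorphic_on_imp_differentiable_at[OF G(1,3)])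
  qed
  ultimately show ?thesis using \<psi>(3,4) by (simp add: norm_mult)
qed

subsection \<open>Lifting along rays\<close>

text \<open>\<open>B_proper\<close> keeps lifts from escaping to the circle; \<open>F_inj\<close>
  makes F regular, so that lifts avoid critical points of B, and lets a critical value determine the
  point where it blocks.\<close>

locale disc_lift =
  fixes B F :: "complex \<Rightarrow> complex"
  assumes B_holo: "B holomorphic_on ball 0 1"
    and F_holo: "F holomorphic_on ball 0 1"
    and F_inj: "inj_on F (ball 0 1)"
    and F_disc: "F ` ball 0 1 \<subseteq> ball 0 1"
    and B_proper: "\<And>\<rho>. \<rho> < 1 \<Longrightarrow> \<exists>\<rho>'<1. \<forall>z\<in>ball 0 1. norm (B z) \<le> \<rho> \<longrightarrow> norm z \<le> \<rho>'"
begin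

definition is_lift :: "complex set \<Rightarrow> (complex \<Rightarrow> complex) \<Rightarrow> bool" where
  "is_lift S G \<longleftrightarrow> open S \<and> S \<subseteq> ball 0 1 \<and> G holomorphic_on S \<and> G ` S \<subseteq> ball 0 1 \<and>
     (\<forall>w\<in>S. B (G w) = F w)"

lemma is_lift_subset: "is_lift S G \<Longrightarrow> T \<subseteq> S \<Longrightarrow> open T \<Longrightarrow> is_lift T G"
  unfolding is_lift_def by (meson holomorphic_on_subset image_mono order_trans subsetD)

lemma deriv_lift:
  assumes "is_lift S G" "w \<in> S"
  shows "deriv B (G w) * deriv G w = deriv F w" and "deriv F w \<noteq> 0" and "deriv B (G w) \<noteq> 0"
proof -
  have S: "open S" "S \<subseteq> ball 0 1" "G holomorphic_on S" "G ` S \<subseteq> ball 0 1"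
    "\<And>w. w \<in> S \<Longrightarrow> B (G w) = F w"
    using assms unfolding is_lift_def by auto
  have "deriv (B \<circ> G) w = deriv B (G w) * deriv G w"
    by (rule deriv_chain)
      (use S assms B_holo in \<open>auto intro: holomorphic_on_imp_differentiable_at simp: image_subset_iff\<close>)
  moreover have "deriv (B \<circ> G) w = deriv F w"
    by (rule deriv_cong_ev)
      (use S assms in \<open>auto simp: eventually_nhds intro!: exI[of _ S]\<close>)
  ultimately show 1: "deriv B (G w) * deriv G w = deriv F w" by simp
  show 2: "deriv F w \<noteq> 0"
    using holomorphic_injective_imp_regular[OF F_holo open_ball F_inj] S assms by blast
  show "deriv B (G w) \<noteq> 0" using 1 2 by auto
qed

text \<open>Lifts never meet critical points, because F' has no zeros. So B is injective near the
  common value, the two lifts coincide near x, and the identity theorem spreads this over S.\<close>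

lemma lifts_agree:
  assumes "is_lift S G" "is_lift S H" "connected S" "x \<in> S" "G x = H x" "w \<in> S"
  shows "G w = H w"
proof -
  have S: "open S" "S \<subseteq> ball 0 1" "G holomorphic_on S" "G ` S \<subseteq> ball 0 1"
    "\<And>w. w \<in> S \<Longrightarrow> B (G w) = F w" "H holomorphic_on S" "H ` S \<subseteq> ball 0 1"
    "\<And>w. w \<in> S \<Longrightarrow> B (H w) = F w"
    using assms unfolding is_lift_def by auto
  obtain r where r: "r > 0" "ball (G x) r \<subseteq> ball 0 1" "inj_on B (ball (G x) r)"
    using has_complex_derivative_locally_injective[OF B_holo _ open_ball, of "G x"]
      deriv_lift(3)[OF assms(1,4)] S(4) assms(4) by (metis image_subset_iff)
  have contG: "continuous_on S G" and contH: "continuous_on S H"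
    using S holomorphic_on_imp_continuous_on by auto
  define U where "U = (S \<inter> G -` ball (G x) r) \<inter> (S \<inter> H -` ball (G x) r)"
  have U: "open U" "x \<in> U" "U \<subseteq> S"
    unfolding U_def using S(1) contG contH r assms(4,5)
    by (blast intro: open_Int continuous_open_preimage open_ball, auto)
  have "G y = H y" if "y \<in> U" for y
    using that r(3) S unfolding U_def inj_on_def by (metis IntE vimage_eq)
  then show ?thesis
    using analytic_continuation_open[of U S G H] U S assms by blast
qed

text \<open>Star-shapedness about 0 survives intersections and unions. Intersections of such domains
  are therefore connected, and lifts with the same value at 0 glue to a single maximal one.\<close>

definition star0 :: "complex set \<Rightarrow> bool" where
  "star0 T \<longleftrightarrow> 0 \<in> T \<and> (\<forall>w\<in>T. closed_segment 0 w \<subseteq> T)"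

lemma star0_connected: "star0 T \<Longrightarrow> connected T"
  unfolding star0_def by (intro starlike_imp_connected) (auto simp: starlike_def)

lemma star0_Int: "star0 S \<Longrightarrow> star0 T \<Longrightarrow> star0 (S \<inter> T)"
  unfolding star0_def by auto

definition lift_dom :: "complex \<Rightarrow> complex set" where
  "lift_dom a = \<Union>{T. \<exists>G. is_lift T G \<and> star0 T \<and> G 0 = a}"

lemma maximal_lift:
  assumes "lift_dom a \<noteq> {}"
  obtains G where "is_lift (lift_dom a) G" "star0 (lift_dom a)" "G 0 = a"
proof -
  let ?P = "\<lambda>T G. is_lift T G \<and> star0 T \<and> G 0 = a"
  have ag: "G w = H w" if T: "?P T G" and S: "?P S H" and w: "w \<in> S" "w \<in> T" for S T G H w
  proof (rule lifts_agree[of "S \<inter> T" G H 0])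
    have "open (S \<inter> T)" using T S unfolding is_lift_def by blast
    then show "is_lift (S \<inter> T) G" "is_lift (S \<inter> T) H"
      using T S by (blast intro: is_lift_subset)+
    show "connected (S \<inter> T)" using T S by (blast intro: star0_connected star0_Int)
  qed (use T S w in \<open>simp_all add: star0_def\<close>)
  define G where "G w = (THE z. \<exists>T H. ?P T H \<and> w \<in> T \<and> H w = z)" for w
  have G_eq: "G w = H w" if "?P T H" "w \<in> T" for T H w
    unfolding G_def
  proof (rule the_equality)
    show "\<exists>T' H'. ?P T' H' \<and> w \<in> T' \<and> H' w = H w" using that by blast
    show "z = H w" if z: "\<exists>T' H'. ?P T' H' \<and> w \<in> T' \<and> H' w = z" for z
    proof -
      from z obtain T' H' where z': "?P T' H' \<and> w \<in> T' \<and> H' w = z" by (elim exE)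
      have "H' w = H w" by (rule ag[of T' H' T H]) (use z' \<open>?P T H\<close> \<open>w \<in> T\<close> in simp_all)
      then show ?thesis using z' by simp
    qed
  qed
  have openD: "open (lift_dom a)"
    unfolding lift_dom_def is_lift_def by auto
  have "G holomorphic_on lift_dom a"
    unfolding holomorphic_on_def
  proof
    fix w assume "w \<in> lift_dom a"
    then obtain T H where T: "?P T H" "w \<in> T" unfolding lift_dom_def by auto
    have "H holomorphic_on T" "open T"
      using T unfolding is_lift_def by auto
    moreover have "G holomorphic_on T \<longleftrightarrow> H holomorphic_on T"
      by (rule holomorphic_cong) (use G_eq T in auto)
    ultimately have "G field_differentiable at w"
      using T by (auto intro: holomorphic_on_imp_differentiable_at)
    then show "G field_differentiable at w within lift_dom a"
      by (rule field_differentiable_at_within)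
  qed
  moreover have "G w \<in> ball 0 1 \<and> B (G w) = F w \<and> w \<in> ball 0 1" if "w \<in> lift_dom a" for w
  proof -
    from that obtain T H where T: "?P T H" "w \<in> T" unfolding lift_dom_def by auto
    then show ?thesis using G_eq[OF T] unfolding is_lift_def by auto
  qed
  ultimately have "is_lift (lift_dom a) G"
    unfolding is_lift_def using openD by auto
  moreover from assms obtain T H where T: "?P T H" unfolding lift_dom_def by auto
  then have "G 0 = a" using G_eq[OF T, of 0] unfolding star0_def by auto
  moreover have "star0 (lift_dom a)"
    using T unfolding star0_def lift_dom_def by blast
  ultimately show ?thesis using that by blast
qed

text \<open>The local inverse of B at c composed with F. The last clause serves to recognise another
  lift as \<open>H\<close> once it comes close to c.\<close>

lemma local_lift:
  assumes c: "c \<in> ball 0 1" "deriv B c \<noteq> 0" "B c = F w" and w: "w \<in> ball 0 1"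
  obtains r \<epsilon> H where "r > 0" "\<epsilon> > 0" "is_lift (ball w r) H" "H w = c"
    "\<And>x z. x \<in> ball w r \<Longrightarrow> z \<in> ball c \<epsilon> \<Longrightarrow> B z = F x \<Longrightarrow> z = H x"
proof -
  obtain \<epsilon> where \<epsilon>: "\<epsilon> > 0" "ball c \<epsilon> \<subseteq> ball 0 1" "open (B ` ball c \<epsilon>)" "inj_on B (ball c \<epsilon>)"
    using has_complex_derivative_locally_invertible[OF B_holo c(1) open_ball c(2)] by blast
  obtain K where K: "K holomorphic_on B ` ball c \<epsilon>" "\<And>z. z \<in> ball c \<epsilon> \<Longrightarrow> K (B z) = z"
    using holomorphic_has_inverse[OF holomorphic_on_subset[OF B_holo \<epsilon>(2)] open_ball \<epsilon>(4)] by metis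
  have "open (ball 0 1 \<inter> F -` (B ` ball c \<epsilon>))"
    using F_holo \<epsilon>(3) by (intro continuous_open_preimage holomorphic_on_imp_continuous_on) auto
  moreover have "w \<in> ball 0 1 \<inter> F -` (B ` ball c \<epsilon>)"
    using w c \<epsilon>(1) by (auto intro!: image_eqI[of _ _ c])
  ultimately obtain r where r: "r > 0" "ball w r \<subseteq> ball 0 1 \<inter> F -` (B ` ball c \<epsilon>)"
    by (meson open_contains_ball)
  have "is_lift (ball w r) (K \<circ> F)"
    unfolding is_lift_def
  proof (intro conjI)
    show "K \<circ> F holomorphic_on ball w r"
      by (rule holomorphic_on_compose_gen[OF holomorphic_on_subset[OF F_holo] K(1)]) (use r in auto)
    have *: "K (F x) \<in> ball c \<epsilon> \<and> B (K (F x)) = F x" if "x \<in> ball w r" for x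
    proof -
      have "F x \<in> B ` ball c \<epsilon>" using r that by blast
      then obtain z where "z \<in> ball c \<epsilon>" "F x = B z" by (rule imageE)
      then show ?thesis using K(2) by metis
    qed
    show "(K \<circ> F) ` ball w r \<subseteq> ball 0 1" "\<forall>x\<in>ball w r. B ((K \<circ> F) x) = F x"
      using * \<epsilon>(2) by force+
  qed (use r in auto)
  moreover have "(K \<circ> F) w = c" using K(2)[of c] c(3) \<epsilon>(1) by simp
  moreover have "z = (K \<circ> F) x" if "z \<in> ball c \<epsilon>" "B z = F x" for x z
    using that K(2) by fastforce
  ultimately show ?thesis using that r(1) \<epsilon>(1) by blast
qed

lemma lift_dom_nonempty:
  assumes "a \<in> ball 0 1" "deriv B a \<noteq> 0" "B a = F 0"
  shows "lift_dom a \<noteq> {}"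
proof (rule local_lift[OF assms])
  fix r \<epsilon> H assume "r > 0" "is_lift (ball 0 r) H" "H 0 = a"
  moreover from this have "star0 (ball 0 r)"
    unfolding star0_def by (blast intro: closed_segment_subset[THEN subsetD] centre_in_ball[THEN iffD2] convex_ball)
  ultimately have "0 \<in> lift_dom a" unfolding lift_dom_def by auto
  then show ?thesis by auto
qed simp

section \<open>Blocked rays and the critical points where their lifts end\<close>

definition blocked :: "complex \<Rightarrow> complex \<Rightarrow> bool" where
  "blocked a w \<longleftrightarrow> w \<in> ball 0 1 \<and> w \<notin> lift_dom a \<and> (\<forall>t\<in>{0..<1}. of_real t * w \<in> lift_dom a)"

definition maxlift :: "complex \<Rightarrow> complex \<Rightarrow> complex" where
  "maxlift a = (SOME G. is_lift (lift_dom a) G \<and> G 0 = a)"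

lemma maxlift:
  assumes "lift_dom a \<noteq> {}"
  shows "is_lift (lift_dom a) (maxlift a)" "star0 (lift_dom a)" "maxlift a 0 = a"
proof -
  obtain G where G: "is_lift (lift_dom a) G" "star0 (lift_dom a)" "G 0 = a"
    using maximal_lift[OF assms] .
  then show "star0 (lift_dom a)" by simp
  have "\<exists>G. is_lift (lift_dom a) G \<and> G 0 = a" using G by blast
  from someI_ex[OF this] show "is_lift (lift_dom a) (maxlift a)" "maxlift a 0 = a"
    unfolding maxlift_def by simp_all
qed

text \<open>The lift along the ray tends to c as t increases to 1. The clause 0 <= t is there
  because s may be negative, while a blocked ray is controlled only for t in [0,1).\<close>

definition ends_at :: "complex \<Rightarrow> complex \<Rightarrow> complex \<Rightarrow> bool" where
  "ends_at a w c \<longleftrightarrow>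
     (\<forall>\<epsilon>>0. \<exists>s<1. \<forall>t. 0 \<le> t \<longrightarrow> s < t \<longrightarrow> t < 1 \<longrightarrow> maxlift a (of_real t * w) \<in> ball c \<epsilon>)"

text \<open>Were B locally invertible at the cluster point c, the local lift around w would agree
  with the maximal lift at a point y of the ray near w and extend it to w, which lies outside the
  maximal domain. Assuming only a cluster point lets the lemma be applied before convergence is
  known.\<close>

lemma blocked_no_limit_regular:
  assumes D: "lift_dom a \<noteq> {}" and bl: "blocked a w"
    and c: "c \<in> ball 0 1" "B c = F w"
    and freq: "\<And>\<epsilon> s. \<epsilon> > 0 \<Longrightarrow> s < 1 \<Longrightarrow> \<exists>t. 0 \<le> t \<and> s < t \<and> t < 1 \<and> maxlift a (of_real t * w) \<in> ball c \<epsilon>"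
  shows "deriv B c = 0"
proof (rule ccontr)
  assume "deriv B c \<noteq> 0"
  note G = maxlift[OF D]
  let ?G = "maxlift a"
  have w: "w \<in> ball 0 1" "w \<notin> lift_dom a" "\<And>t. 0 \<le> t \<Longrightarrow> t < 1 \<Longrightarrow> of_real t * w \<in> lift_dom a"
    using bl unfolding blocked_def by auto
  have "0 \<in> lift_dom a" using G(2) unfolding star0_def by auto
  with w(2) have "w \<noteq> 0" by auto
  obtain r \<epsilon> H where H: "r > 0" "\<epsilon> > 0" "is_lift (ball w r) H" "H w = c"
    "\<And>x z. x \<in> ball w r \<Longrightarrow> z \<in> ball c \<epsilon> \<Longrightarrow> B z = F x \<Longrightarrow> z = H x"
    using local_lift[OF c(1) \<open>deriv B c \<noteq> 0\<close> c(2) w(1)] by metis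
  have "1 - r / norm w < 1" using H(1) \<open>w \<noteq> 0\<close> by simp
  from freq[OF H(2) this] obtain t where t: "0 \<le> t" "1 - r / norm w < t" "t < 1"
    "?G (of_real t * w) \<in> ball c \<epsilon>" by blast
  define y where "y = of_real t * w"
  have yD: "y \<in> lift_dom a" using w(3) t y_def by auto
  have "w - y = of_real (1 - t) * w" unfolding y_def by (simp add: algebra_simps)
  then have "dist w y = (1 - t) * norm w"
    using t by (simp only: dist_norm norm_mult norm_of_real abs_of_nonneg)
  also have "\<dots> < r" using t \<open>w \<noteq> 0\<close> by (simp add: field_simps)
  finally have yr: "y \<in> ball w r" by simp
  have GH: "?G y = H y"
    using H(5)[OF yr] t(4) G(1) yD unfolding is_lift_def y_def by auto
  have seg1: "closed_segment 0 y \<subseteq> lift_dom a" using G(2) yD unfolding star0_def by auto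
  have seg2: "closed_segment y w \<subseteq> ball w r" using yr H(1) by (intro closed_segment_subset) auto
  have opD: "open (lift_dom a)" using G(1) unfolding is_lift_def by auto
  obtain e1 where e1: "e1 > 0" "(\<Union>x\<in>closed_segment 0 y. ball x e1) \<subseteq> lift_dom a"
    using compact_subset_open_imp_ball_epsilon_subset[OF compact_segment opD seg1] by metis
  obtain e2 where e2: "e2 > 0" "(\<Union>x\<in>closed_segment y w. ball x e2) \<subseteq> ball w r"
    using compact_subset_open_imp_ball_epsilon_subset[OF compact_segment open_ball seg2] by metis
  \<comment> \<open>A common radius for both tubes: each is convex, so their overlap is connected,
    and their union is the tube around the whole segment from 0 to w, again convex and hence
    star-shaped about 0.\<close>
  define e where "e = min e1 e2"
  define tube :: "complex \<Rightarrow> complex \<Rightarrow> complex set"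
    where "tube = (\<lambda>p q. \<Union>x\<in>closed_segment p q. \<Union>v\<in>ball 0 e. {x + v})"
  have e: "e > 0" "e \<le> e1" "e \<le> e2" using e1 e2 e_def by auto
  have tube_conv: "convex (tube p q)" and tube_open: "open (tube p q)" for p q
    unfolding tube_def by (intro convex_sums open_sums convex_closed_segment convex_ball disjI2 open_ball)+
  have tube_eq: "tube p q = (\<Union>x\<in>closed_segment p q. ball x e)" for p q
  proof -
    have "(\<Union>v\<in>ball 0 e. {x + v}) = ball x e" for x :: complex
      using ball_translation[of x 0 e] by (auto simp: image_def)
    then show ?thesis unfolding tube_def by simp
  qed
  have sub: "tube 0 y \<subseteq> lift_dom a" "tube y w \<subseteq> ball w r"
    unfolding tube_eq
    by (rule order_trans[OF UN_mono[OF order_refl subset_ball] e1(2)],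
        rule e, rule order_trans[OF UN_mono[OF order_refl subset_ball] e2(2)], rule e)
  have "y \<in> closed_segment 0 w"
    unfolding y_def closed_segment_def using t by (auto simp: scaleR_conv_of_real intro!: exI[of _ t])
  then have seg: "closed_segment 0 w = closed_segment 0 y \<union> closed_segment y w"
    by (simp add: Un_closed_segment)
  have tube_un: "tube 0 w = tube 0 y \<union> tube y w"
    unfolding tube_eq seg by blast
  have tube_ends: "p \<in> tube p q" "q \<in> tube p q" for p q
    unfolding tube_eq using e(1) by (auto intro: bexI[of _ p] bexI[of _ q])
  then have inter: "y \<in> tube 0 y \<inter> tube y w" by auto
  have ag: "?G x = H x" if "x \<in> tube 0 y \<inter> tube y w" for x
  proof (rule lifts_agree[of "tube 0 y \<inter> tube y w" ?G H y])
    show "connected (tube 0 y \<inter> tube y w)"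
      by (intro convex_connected convex_Int tube_conv)
    show "is_lift (tube 0 y \<inter> tube y w) ?G"
      by (rule is_lift_subset[OF G(1)]) (use sub tube_open in auto)
    show "is_lift (tube 0 y \<inter> tube y w) H"
      by (rule is_lift_subset[OF H(3)]) (use sub tube_open in auto)
  qed (use inter GH that in auto)
  define M where "M = (\<lambda>x. if x \<in> tube 0 y then ?G x else H x)"
  have "is_lift (tube 0 w) M"
    unfolding is_lift_def
  proof (intro conjI)
    have "?G holomorphic_on tube 0 y" "H holomorphic_on tube y w"
      using is_lift_subset[OF G(1) sub(1) tube_open] is_lift_subset[OF H(3) sub(2) tube_open]
      unfolding is_lift_def by auto
    then show "M holomorphic_on tube 0 w"
      unfolding M_def tube_un
      by (intro holomorphic_on_If_Un tube_open) (use ag in auto)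
    have GH': "?G x \<in> ball 0 1 \<and> B (?G x) = F x \<and> x \<in> ball 0 1" if "x \<in> tube 0 y" for x
      using that sub(1) G(1) unfolding is_lift_def by blast
    have HH': "H x \<in> ball 0 1 \<and> B (H x) = F x \<and> x \<in> ball 0 1" if "x \<in> tube y w" for x
      using that sub(2) H(3) unfolding is_lift_def by blast
    show "tube 0 w \<subseteq> ball 0 1" "M ` tube 0 w \<subseteq> ball 0 1" "\<forall>x\<in>tube 0 w. B (M x) = F x"
      using GH' HH' unfolding tube_un M_def by auto
  qed (rule tube_open)
  moreover have "0 \<in> tube 0 w" "w \<in> tube 0 w" "0 \<in> tube 0 y" using tube_ends by auto
  moreover have "star0 (tube 0 w)"
    unfolding star0_def using tube_conv \<open>0 \<in> tube 0 w\<close> by (auto simp: closed_segment_subset)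
  moreover have "M 0 = a" using \<open>0 \<in> tube 0 y\<close> G(3) unfolding M_def by simp
  ultimately have "w \<in> lift_dom a" unfolding lift_dom_def by blast
  with w(2) show False by simp
qed

text \<open>|B| along the lift equals |F| on a compact segment, hence stays below some constant less
  than 1; properness then confines the lift and yields a cluster point, which must be critical. That
  it is a limit follows from the isolation of preimages of \<open>F w\<close>.\<close>

lemma blocked_ends_at_critical:
  assumes D: "lift_dom a \<noteq> {}" and bl: "blocked a w"
  obtains c where "c \<in> ball 0 1" "B c = F w" "deriv B c = 0" "ends_at a w c"
proof -
  note G = maxlift[OF D]
  let ?G = "maxlift a"
  have w: "w \<in> ball 0 1" "w \<notin> lift_dom a" "\<And>t. 0 \<le> t \<Longrightarrow> t < 1 \<Longrightarrow> of_real t * w \<in> lift_dom a"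
    using bl unfolding blocked_def by auto
  have "0 \<in> lift_dom a" using G(2) unfolding star0_def by auto
  with w(2) have "w \<noteq> 0" by auto
  have Gprops: "?G x \<in> ball 0 1" "B (?G x) = F x" if "x \<in> lift_dom a" for x
    using G(1) that unfolding is_lift_def by auto
  have segD: "closed_segment 0 w \<subseteq> ball 0 1"
    using w(1) by (intro closed_segment_subset) auto
  have contF: "continuous_on (ball 0 1) F" and contB: "continuous_on (ball 0 1) B"
    using F_holo B_holo by (auto intro: holomorphic_on_imp_continuous_on)
  have "continuous_on (closed_segment 0 w) (\<lambda>x. norm (F x))"
    using contF segD by (intro continuous_intros) (rule continuous_on_subset)
  then obtain x0 where x0: "x0 \<in> closed_segment 0 w"
    "\<And>x. x \<in> closed_segment 0 w \<Longrightarrow> norm (F x) \<le> norm (F x0)"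
    using continuous_attains_sup[of "closed_segment 0 w" "\<lambda>x. norm (F x)"] by auto
  then have "F x0 \<in> ball 0 1" using segD F_disc by blast
  then have "norm (F x0) < 1" by simp
  then obtain \<rho> where \<rho>: "\<rho> < 1" "\<And>z. z \<in> ball 0 1 \<Longrightarrow> norm (B z) \<le> norm (F x0) \<Longrightarrow> norm z \<le> \<rho>"
    using B_proper by blast
  have inseg: "of_real t * w \<in> closed_segment 0 w" if "0 \<le> t" "t \<le> 1" for t
    unfolding closed_segment_def using that by (auto simp: scaleR_conv_of_real intro!: exI[of _ t])
  have bnd: "?G (of_real t * w) \<in> cball 0 \<rho>" if "0 \<le> t" "t < 1" for t
    using \<rho>(2)[of "?G (of_real t * w)"] Gprops[OF w(3)[OF that]] x0(2)[OF inseg] that by auto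
  define \<tau> where "\<tau> = (\<lambda>k::nat. 1 - inverse (real (Suc k)))"
  have \<tau>: "0 \<le> \<tau> k" "\<tau> k < 1" for k unfolding \<tau>_def by (auto simp: field_simps)
  have \<tau>lim: "\<tau> \<longlonglongrightarrow> 1"
    unfolding \<tau>_def using tendsto_diff[OF tendsto_const LIMSEQ_inverse_real_of_nat, of 1] by simp
  have "\<forall>k. ?G (of_real (\<tau> k) * w) \<in> cball 0 \<rho>" using bnd \<tau> by auto
  then obtain c \<phi> where c: "c \<in> cball 0 \<rho>" "strict_mono \<phi>"
    "((\<lambda>k. ?G (of_real (\<tau> k) * w)) \<circ> \<phi>) \<longlonglongrightarrow> c"
    using compact_cball[of "0::complex" \<rho>] unfolding compact_def by metis
  have cball: "c \<in> ball 0 1" using c(1) \<rho>(1) by auto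
  have \<tau>lim': "(\<tau> \<circ> \<phi>) \<longlonglongrightarrow> 1" using \<tau>lim c(2) by (rule LIMSEQ_subseq_LIMSEQ)
  have limF: "((\<lambda>t::real. F (of_real t * w)) \<longlongrightarrow> F w) (at 1)"
  proof -
    have 1: "isCont F w" using contF w(1) by (simp add: continuous_on_eq_continuous_at)
    have 2: "((\<lambda>t::real. of_real t * w) \<longlongrightarrow> w) (at 1)"
      by (rule tendsto_eq_intros refl | simp)+
    show ?thesis by (rule isCont_tendsto_compose[OF 1 2])
  qed
  have Bc: "B c = F w"
  proof (rule LIMSEQ_unique)
    have "isCont B c" using contB cball by (simp add: continuous_on_eq_continuous_at)
    from isCont_tendsto_compose[OF this c(3)]
    show "(\<lambda>k. B (((\<lambda>k. ?G (of_real (\<tau> k) * w)) \<circ> \<phi>) k)) \<longlonglongrightarrow> B c" .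
    have "(\<lambda>k. F (of_real ((\<tau> \<circ> \<phi>) k) * w)) \<longlonglongrightarrow> F w"
    proof (rule filterlim_compose[OF limF])
      show "filterlim (\<tau> \<circ> \<phi>) (at 1) sequentially"
        unfolding filterlim_at using \<tau>lim' \<tau> by (auto intro!: always_eventually simp: less_imp_neq)
    qed
    then show "(\<lambda>k. B (((\<lambda>k. ?G (of_real (\<tau> k) * w)) \<circ> \<phi>) k)) \<longlonglongrightarrow> F w"
      using Gprops(2) w(3) \<tau> by (auto simp: o_def)
  qed
  have freq: "\<exists>t. 0 \<le> t \<and> s < t \<and> t < 1 \<and> ?G (of_real t * w) \<in> ball c \<epsilon>" if "\<epsilon> > 0" "s < 1" for \<epsilon> s
  proof -
    have "\<forall>\<^sub>F k in sequentially. dist (((\<lambda>k. ?G (of_real (\<tau> k) * w)) \<circ> \<phi>) k) c < \<epsilon>"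
      using c(3) that(1) by (rule tendstoD)
    moreover have "\<forall>\<^sub>F k in sequentially. s < (\<tau> \<circ> \<phi>) k"
      using \<tau>lim' that(2) by (rule order_tendstoD)
    ultimately have "\<forall>\<^sub>F k in sequentially. dist (((\<lambda>k. ?G (of_real (\<tau> k) * w)) \<circ> \<phi>) k) c < \<epsilon> \<and> s < (\<tau> \<circ> \<phi>) k"
      by (rule eventually_conj)
    then obtain k where "dist (((\<lambda>k. ?G (of_real (\<tau> k) * w)) \<circ> \<phi>) k) c < \<epsilon> \<and> s < (\<tau> \<circ> \<phi>) k"
      using eventually_happens' sequentially_bot by blast
    then show ?thesis using \<tau>[of "\<phi> k"] by (auto simp: dist_commute)
  qed
  have "deriv B c = 0"
    by (rule blocked_no_limit_regular[OF D bl cball Bc freq])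
  moreover have "ends_at a w c"
    unfolding ends_at_def
  proof (intro allI impI)
    fix \<epsilon> :: real assume "\<epsilon> > 0"
    have "a \<in> ball 0 1" "B a = F 0"
      using Gprops[OF \<open>0 \<in> lift_dom a\<close>] G(3) by auto
    moreover have "F 0 \<noteq> F w"
      using F_inj w(1) \<open>w \<noteq> 0\<close> by (auto simp: inj_on_def)
    moreover have "(\<lambda>z. B z - F w) holomorphic_on ball 0 1"
      by (intro holomorphic_intros B_holo)
    ultimately obtain r where r: "r > 0" "ball c r \<subseteq> ball 0 1"
      "\<And>z. z \<in> ball c r - {c} \<Longrightarrow> B z - F w \<noteq> 0"
      using isolated_zeros[of "\<lambda>z. B z - F w" "ball 0 1" c a] cball Bc by auto
    \<comment> \<open>On the circle of radius delta about c, |B - F w| has a positive minimum eta.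
      Once F(t w) is within eta of F w the lifted path cannot cross this circle, and since it keeps
      returning to its interior it stays there.\<close>
    define \<delta> where "\<delta> = min \<epsilon> (r / 2)"
    have \<delta>: "\<delta> > 0" "\<delta> \<le> \<epsilon>" "cball c \<delta> \<subseteq> ball c r"
      using r(1) \<open>\<epsilon> > 0\<close> unfolding \<delta>_def by auto
    have "continuous_on (sphere c \<delta>) (\<lambda>z. norm (B z - F w))"
      using \<delta> r by (intro continuous_intros continuous_on_subset[OF contB]) auto
    moreover have "sphere c \<delta> \<noteq> {}" using \<delta> by simp
    ultimately obtain z0 where z0: "z0 \<in> sphere c \<delta>"
      "\<And>z. z \<in> sphere c \<delta> \<Longrightarrow> norm (B z0 - F w) \<le> norm (B z - F w)"
      using continuous_attains_inf[of "sphere c \<delta>" "\<lambda>z. norm (B z - F w)"] by auto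
    define \<eta> where "\<eta> = norm (B z0 - F w)"
    have "z0 \<in> ball c r - {c}" using z0(1) \<delta> by auto
    then have "\<eta> > 0" using r(3) unfolding \<eta>_def by simp
    from tendstoD[OF limF this] obtain d where d: "d > 0"
      "\<And>t. t \<noteq> 1 \<Longrightarrow> dist t 1 < d \<Longrightarrow> dist (F (of_real t * w)) (F w) < \<eta>"
      unfolding eventually_at by auto
    define s where "s = max 0 (1 - d)"
    have s: "s < 1" "0 \<le> s" using d(1) s_def by auto
    have contG: "continuous_on {s<..<1} (\<lambda>t. ?G (of_real t * w))"
    proof (rule continuous_on_compose2[of "lift_dom a" ?G])
      show "continuous_on (lift_dom a) ?G"
        using G(1) unfolding is_lift_def by (auto intro: holomorphic_on_imp_continuous_on)
    qed (use w(3) s in \<open>auto intro!: continuous_intros\<close>)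
    define A where "A = (\<lambda>t. ?G (of_real t * w)) ` {s<..<1}"
    have A_conn: "connected A" unfolding A_def by (intro connected_continuous_image contG) auto
    have A_fr: "A \<inter> frontier (ball c \<delta>) = {}"
    proof -
      have "?G (of_real t * w) \<notin> sphere c \<delta>" if "s < t" "t < 1" for t
      proof
        assume "?G (of_real t * w) \<in> sphere c \<delta>"
        from z0(2)[OF this] have "\<eta> \<le> dist (F (of_real t * w)) (F w)"
          using Gprops(2)[OF w(3)[of t]] that s unfolding \<eta>_def by (simp add: dist_norm)
        moreover have "dist (F (of_real t * w)) (F w) < \<eta>"
          using that unfolding s_def by (intro d(2)) (auto simp: dist_real_def)
        ultimately show False by simp
      qed
      then show ?thesis unfolding A_def using \<delta>(1) by auto
    qed
    have A_ball: "A \<inter> ball c \<delta> \<noteq> {}"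
    proof -
      obtain t where "0 \<le> t \<and> s < t \<and> t < 1 \<and> ?G (of_real t * w) \<in> ball c \<delta>"
        using freq[OF \<delta>(1) s(1)] by blast
      then have "?G (of_real t * w) \<in> A \<inter> ball c \<delta>" unfolding A_def by simp
      then show ?thesis by blast
    qed
    have A_sub: "A \<subseteq> ball c \<delta>"
    proof (rule ccontr)
      assume "\<not> A \<subseteq> ball c \<delta>"
      then have "A - ball c \<delta> \<noteq> {}" by (simp add: Diff_eq_empty_iff)
      from connected_Int_frontier[OF A_conn A_ball this] A_fr show False by (rule notE)
    qed
    have "\<forall>t. 0 \<le> t \<longrightarrow> s < t \<longrightarrow> t < 1 \<longrightarrow> ?G (of_real t * w) \<in> ball c \<epsilon>"
    proof (intro allI impI)
      fix t :: real assume "s < t" "t < 1"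
      then have "?G (of_real t * w) \<in> A" unfolding A_def by (intro imageI) simp
      then show "?G (of_real t * w) \<in> ball c \<epsilon>"
        using A_sub subset_ball[OF \<delta>(2), of c] by (meson subsetD)
    qed
    then show "\<exists>s<1. \<forall>t. 0 \<le> t \<longrightarrow> s < t \<longrightarrow> t < 1 \<longrightarrow> ?G (of_real t * w) \<in> ball c \<epsilon>"
      using s(1) by (intro exI[of _ s] conjI)
  qed
  ultimately show ?thesis using that cball Bc by blast
qed

text \<open>Just before w all these lifts lie near c over the same value F y. They are pairwise
  distinct, for lifts that meet once share their starting point; so their images under
  \<open>h\<close> are distinct k-th roots of F y - F w.\<close>

lemma card_ends_at:
  assumes A: "finite A" "\<And>a. a \<in> A \<Longrightarrow> lift_dom a \<noteq> {} \<and> blocked a w \<and> ends_at a w c"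
    and c: "c \<in> ball 0 1" "B c = F w"
    and h: "r > 0" "inj_on h (ball c r)" "\<And>z. z \<in> ball c r \<Longrightarrow> B z - B c = h z ^ k" "k > 0"
  shows "card A \<le> k"
proof (cases "A = {}")
  case False
  have "\<forall>a\<in>A. \<exists>s<1. \<forall>t. 0 \<le> t \<longrightarrow> s < t \<longrightarrow> t < 1 \<longrightarrow> maxlift a (of_real t * w) \<in> ball c r"
    using A(2) h(1) unfolding ends_at_def by blast
  then obtain s where s: "\<And>a. a \<in> A \<Longrightarrow> s a < 1"
    "\<And>a t. a \<in> A \<Longrightarrow> 0 \<le> t \<Longrightarrow> s a < t \<Longrightarrow> t < 1 \<Longrightarrow> maxlift a (of_real t * w) \<in> ball c r"
    by metis
  \<comment> \<open>A parameter t beyond M works for all lifts at once; inserting 0 ensures t >= 0,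
    and t < 1 makes y differ from w, so that F y - F w is nonzero.\<close>
  define M where "M = Max (insert (0::real) (s ` A))"
  have "M < 1" unfolding M_def using A(1) s(1) by (subst Max_less_iff) auto
  moreover have M: "0 \<le> M" "\<And>a. a \<in> A \<Longrightarrow> s a \<le> M" unfolding M_def using A(1) by auto
  ultimately obtain t where t: "M < t" "t < 1" using dense by blast
  have t0: "0 \<le> t" using t M by auto
  define y where "y = of_real t * w"
  have y: "y \<in> lift_dom a" "maxlift a y \<in> ball c r" "B (maxlift a y) = F y" if "a \<in> A" for a
  proof -
    show "y \<in> lift_dom a" using A(2)[OF that] t t0 unfolding blocked_def y_def by auto
    then show "B (maxlift a y) = F y"
      using maxlift(1)[of a] A(2)[OF that] unfolding is_lift_def by auto
    show "maxlift a y \<in> ball c r"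
      using s(2)[OF that t0 _ t(2)] M(2)[OF that] t unfolding y_def by linarith
  qed
  obtain a0 where "a0 \<in> A" using False by auto
  then have w: "w \<in> ball 0 1" "w \<noteq> y"
    using A(2)[of a0] y(1)[of a0] unfolding blocked_def by auto
  have "y \<in> ball 0 1"
    using y(1)[OF \<open>a0 \<in> A\<close>] maxlift(1)[of a0] A(2)[OF \<open>a0 \<in> A\<close>] unfolding is_lift_def by blast
  then have "F y \<noteq> F w" using F_inj w by (auto simp: inj_on_def)
  then have card: "card {x. x ^ k = F y - F w} = k" using h(4) by (intro card_nth_roots) auto
  then have fin: "finite {x. x ^ k = F y - F w}" using h(4) card_ge_0_finite by force
  have "inj_on (\<lambda>a. h (maxlift a y)) A"
  proof (rule inj_onI)
    fix a b assume ab: "a \<in> A" "b \<in> A" "h (maxlift a y) = h (maxlift b y)"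
    then have eq: "maxlift a y = maxlift b y" using h(2) y(2) unfolding inj_on_def by blast
    note La = maxlift[of a] and Lb = maxlift[of b]
    have D: "lift_dom a \<noteq> {}" "lift_dom b \<noteq> {}" using A(2) ab by auto
    have "maxlift a 0 = maxlift b 0"
    proof (rule lifts_agree[of "lift_dom a \<inter> lift_dom b" "maxlift a" "maxlift b" y 0])
      show "connected (lift_dom a \<inter> lift_dom b)"
        using La(2) Lb(2) D by (intro star0_connected star0_Int)
      have "open (lift_dom a \<inter> lift_dom b)" using La(1) Lb(1) D unfolding is_lift_def by auto
      then show "is_lift (lift_dom a \<inter> lift_dom b) (maxlift a)"
        "is_lift (lift_dom a \<inter> lift_dom b) (maxlift b)"
        using La(1) Lb(1) D by (auto intro: is_lift_subset)
    qed (use y ab eq La(2) Lb(2) D in \<open>auto simp: star0_def\<close>)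
    then show "a = b" using La(3) Lb(3) D by simp
  qed
  moreover have "(\<lambda>a. h (maxlift a y)) ` A \<subseteq> {x. x ^ k = F y - F w}"
    using h(3)[OF y(2)] y(3) c(2) by auto
  ultimately have "card A \<le> card {x. x ^ k = F y - F w}"
    using fin by (metis card_inj_on_le)
  with card show ?thesis by simp
qed auto

lemma not_in_lift_dom_imp_blocked:
  assumes D: "lift_dom a \<noteq> {}" and w: "w \<in> ball 0 1" "w \<notin> lift_dom a"
  obtains s where "0 < s" "s \<le> 1" "blocked a (of_real s * w)"
proof -
  note G = maxlift[OF D]
  have "0 \<in> lift_dom a" using G(2) unfolding star0_def by auto
  define T where "T = {t::real. 0 \<le> t \<and> t \<le> 1 \<and> of_real t * w \<notin> lift_dom a}"
  have op: "open (lift_dom a)" using G(1) unfolding is_lift_def by auto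
  have "open ((\<lambda>t::real. of_real t * w) -` lift_dom a)"
    by (intro open_vimage op continuous_intros)
  then have "closed (- ((\<lambda>t::real. of_real t * w) -` lift_dom a))" by auto
  then have "closed ({0..1} \<inter> - ((\<lambda>t::real. of_real t * w) -` lift_dom a))"
    by (intro closed_Int) auto
  moreover have T_eq: "T = {0..1} \<inter> - ((\<lambda>t::real. of_real t * w) -` lift_dom a)"
    unfolding T_def by auto
  ultimately have "closed T" by simp
  moreover have "1 \<in> T" using w unfolding T_def by auto
  moreover have bdd: "bdd_below T" unfolding T_def by (auto intro!: bdd_belowI[of _ 0])
  ultimately have inf: "Inf T \<in> T" using closed_contains_Inf[of T] by auto
  define s where "s = Inf T"
  have s: "0 \<le> s" "s \<le> 1" "of_real s * w \<notin> lift_dom a" using inf unfolding s_def T_def by auto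
  have "s \<noteq> 0" using s(3) \<open>0 \<in> lift_dom a\<close> by auto
  have below: "of_real t * w \<in> lift_dom a" if "0 \<le> t" "t < s" for t
    using that s(2) cInf_lower[OF _ bdd, of t] unfolding T_def s_def by fastforce
  have "blocked a (of_real s * w)"
    unfolding blocked_def
  proof (intro conjI ballI)
    show "of_real s * w \<in> ball 0 1"
      using s w(1) mult_left_le_one_le[of "norm w" s] by (auto simp: norm_mult)
    fix t :: real assume t: "t \<in> {0..<1}"
    have "of_real (t * s) * w \<in> lift_dom a"
      using t s \<open>s \<noteq> 0\<close> by (intro below) auto
    then show "of_real t * (of_real s * w) \<in> lift_dom a" by (simp add: mult.assoc)
  qed (rule s(3))
  with s \<open>s \<noteq> 0\<close> show ?thesis by (intro that[of s]) auto
qed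

lemma slit_disc_lift:
  assumes Z: "finite Z" "Z \<noteq> {}" "\<And>a. a \<in> Z \<Longrightarrow> a \<in> ball 0 1 \<and> B a = F 0 \<and> deriv B a \<noteq> 0"
    and C: "finite C" "C = {c \<in> ball 0 1. deriv B c = 0}" "(\<Sum>c\<in>C. m c) < card Z"
    and m: "\<And>c. c \<in> C \<Longrightarrow> 1 \<le> m c"
      "\<And>c. c \<in> C \<Longrightarrow> \<exists>h r. r > 0 \<and> inj_on h (ball c r) \<and> (\<forall>z\<in>ball c r. B z - B c = h z ^ Suc (m c))"
  obtains u G where "norm u = 1" "is_lift (slit_disc u) G"
proof -
  have D: "lift_dom a \<noteq> {}" if "a \<in> Z" for a using Z(3)[OF that] lift_dom_nonempty by auto
  have "\<exists>a\<in>Z. \<forall>v w. blocked a v \<longrightarrow> blocked a w \<longrightarrow> v = w"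
  proof (rule ccontr)
    assume "\<not> ?thesis"
    then obtain w1 w2 where w12: "\<And>a. a \<in> Z \<Longrightarrow> blocked a (w1 a) \<and> blocked a (w2 a) \<and> w1 a \<noteq> w2 a"
      by metis
    \<comment> \<open>Two blocked points for every start, tagged by a Boolean, make 2
      \<open>card Z\<close> pairs; each is assigned a critical point where its lift ends.\<close>
    define W where "W = (\<lambda>(a, i). if i then w1 a else w2 a)"
    have Wbl: "blocked (fst p) (W p)" if "p \<in> Z \<times> UNIV" for p
      using that w12 unfolding W_def by (auto split: prod.splits)
    have "\<forall>p\<in>Z \<times> UNIV. \<exists>c. c \<in> C \<and> B c = F (W p) \<and> ends_at (fst p) (W p) c"
    proof
      fix p :: "complex \<times> bool" assume p: "p \<in> Z \<times> UNIV"
      then have "lift_dom (fst p) \<noteq> {}" using D by auto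
      from blocked_ends_at_critical[OF this Wbl[OF p]] C(2)
      show "\<exists>c. c \<in> C \<and> B c = F (W p) \<and> ends_at (fst p) (W p) c" by blast
    qed
    then obtain e where e: "\<And>p. p \<in> Z \<times> UNIV \<Longrightarrow> e p \<in> C \<and> B (e p) = F (W p) \<and> ends_at (fst p) (W p) (e p)"
      by metis
    \<comment> \<open>By injectivity of F all pairs assigned to c share one blocked point. Hence
      both tags of the same start cannot occur, and counting pairs amounts to counting
      starts.\<close>
    have fibre: "card {p \<in> Z \<times> UNIV. e p = c} \<le> Suc (m c)" if c: "c \<in> C" for c
    proof (cases "{p \<in> Z \<times> UNIV. e p = c} = {}")
      case False
      let ?P = "{p \<in> Z \<times> (UNIV::bool set). e p = c}"
      from False obtain p0 where p0: "p0 \<in> ?P" by auto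
      have Weq: "W p = W p0" if "p \<in> ?P" for p
      proof -
        have "F (W p) = F (W p0)" using e[of p] e[of p0] p0 that by auto
        moreover have "W p \<in> ball 0 1" "W p0 \<in> ball 0 1"
          using Wbl[of p] Wbl[of p0] that p0 unfolding blocked_def by auto
        ultimately show ?thesis using F_inj by (auto simp: inj_on_def)
      qed
      have inj: "inj_on fst ?P"
      proof (rule inj_onI)
        fix p q assume pq: "p \<in> ?P" "q \<in> ?P" "fst p = fst q"
        show "p = q"
        proof (rule ccontr)
          assume "p \<noteq> q"
          with pq(3) have "snd p \<noteq> snd q" by (auto simp: prod_eq_iff)
          moreover have "fst p \<in> Z" using pq(1) by auto
          then have "w1 (fst p) \<noteq> w2 (fst p)" using w12 by blast
          ultimately have "W p \<noteq> W q"
            using pq(3) unfolding W_def case_prod_beta by (cases "snd p"; cases "snd q") simp_all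
          then show False using Weq[OF pq(1)] Weq[OF pq(2)] by simp
        qed
      qed
      from m(2)[OF c] obtain h r where hr: "r > 0 \<and> inj_on h (ball c r) \<and> (\<forall>z\<in>ball c r. B z - B c = h z ^ Suc (m c))"
        by (elim exE)
      then have h: "r > 0" "inj_on h (ball c r)" "\<And>z. z \<in> ball c r \<Longrightarrow> B z - B c = h z ^ Suc (m c)"
        by simp_all
      have "card (fst ` ?P) \<le> Suc (m c)"
      proof (rule card_ends_at[where w = "W p0" and c = c and h = h and r = r])
        show "finite (fst ` ?P)" using Z(1) by auto
        show "lift_dom a \<noteq> {} \<and> blocked a (W p0) \<and> ends_at a (W p0) c" if "a \<in> fst ` ?P" for a
        proof -
          from that obtain p where p: "p \<in> ?P" "a = fst p" by auto
          then have p': "p \<in> Z \<times> UNIV" "e p = c" by simp_all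
          then have "a \<in> Z" using p(2) by auto
          moreover have "W p = W p0" by (rule Weq[OF p(1)])
          ultimately show ?thesis using D Wbl[OF p'(1)] e[OF p'(1)] p'(2) p(2) by simp
        qed
        show "c \<in> ball 0 1" "B c = F (W p0)" using c C(2) e[of p0] p0 by auto
      qed (use h in auto)
      then show ?thesis using card_image[OF inj] by simp
    next
      case True
      then show ?thesis by (simp only: card.empty le0)
    qed
    have "2 * card Z = card (Z \<times> (UNIV::bool set))" by (simp add: card_cartesian_product)
    also have "\<dots> = (\<Sum>c\<in>C. card {p \<in> Z \<times> UNIV. e p = c})"
      using sum.group[of "Z \<times> (UNIV::bool set)" C e "\<lambda>_. 1::nat"] Z(1) C(1) e
      by (auto simp: image_subset_iff)
    also have "\<dots> \<le> (\<Sum>c\<in>C. 2 * m c)"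
      using fibre m(1) by (intro sum_mono) fastforce
    also have "\<dots> = 2 * (\<Sum>c\<in>C. m c)" by (simp add: sum_distrib_left)
    finally show False using C(3) by simp
  qed
  then obtain a where a: "a \<in> Z" "\<And>v w. blocked a v \<Longrightarrow> blocked a w \<Longrightarrow> v = w" by blast
  note G = maxlift[OF D[OF a(1)]]
  \<comment> \<open>The direction u is opposite to the sole blocked point; if there is none, any
    direction will do.\<close>
  obtain u where u: "norm u = 1" "\<And>v. blocked a v \<Longrightarrow> v = - of_real (norm v) * u"
  proof (cases "\<exists>v. blocked a v")
    case True
    then obtain v where v: "blocked a v" by auto
    have "0 \<in> lift_dom a" using G(2) unfolding star0_def by auto
    with v have "v \<noteq> 0" unfolding blocked_def by auto
    show ?thesis
    proof (rule that[of "- v / of_real (norm v)"])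
      show "x = - of_real (norm x) * (- v / of_real (norm v))" if "blocked a x" for x
        using a(2)[OF that v] \<open>v \<noteq> 0\<close> by simp
    qed (use \<open>v \<noteq> 0\<close> in \<open>simp add: norm_divide\<close>)
  qed (use that[of 1] in auto)
  have "slit_disc u \<subseteq> lift_dom a"
  proof
    fix w assume w: "w \<in> slit_disc u"
    show "w \<in> lift_dom a"
    proof (rule ccontr)
      assume "w \<notin> lift_dom a"
      then obtain s where s: "0 < s" "s \<le> 1" "blocked a (of_real s * w)"
        using not_in_lift_dom_imp_blocked[OF D[OF a(1)]] w unfolding slit_disc_def by blast
      \<comment> \<open>The blocked point on the ray of w points in the direction -u, hence so does
        w, which would put w on the slit.\<close>
      have "of_real s * w = - of_real (s * norm w) * u"
        using u(2)[OF s(3)] s by (simp add: norm_mult)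
      also have "\<dots> = of_real s * (- of_real (norm w) * u)" by simp
      finally have "w = - of_real (norm w) * u" using s(1) unfolding mult_cancel_left by simp
      then show False using w unfolding slit_disc_def by (auto dest: spec[of _ "norm w"])
    qed
  qed
  moreover have "open (slit_disc u)"
  proof -
    have "{- of_real s * u |s. s \<ge> 0} = (\<lambda>s. - of_real s * u) ` {0..}" by auto
    moreover have "closed ((\<lambda>x. x *\<^sub>R (-u)) ` {0..})"
      by (rule closed_injective_linear_image) (use u in \<open>auto intro!: linearI injI simp: algebra_simps\<close>)
    ultimately have "closed {- of_real s * u |s. s \<ge> 0}" by (simp add: scaleR_conv_of_real)
    then show ?thesis unfolding slit_disc_def by auto
  qed
  ultimately have "is_lift (slit_disc u) (maxlift a)" using is_lift_subset[OF G(1)] by auto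
  then show ?thesis using that u(1) by blast
qed

end

subsection \<open>Convex univalent functions\<close>

text \<open>With E(t) = E(0) + t q(t) the second difference quotient becomes (q(t) - q(-t)) / t,
  whose limit 2 q'(0) equals E''(0).\<close>

lemma symmetric_second_difference_limit:
  fixes E :: "complex \<Rightarrow> complex"
  assumes E: "E holomorphic_on ball 0 r" and r: "r > 0"
  shows "((\<lambda>t. (E t + E (- t) - 2 * E 0) / t\<^sup>2) \<longlongrightarrow> deriv (deriv E) 0) (at 0)"
proof -
  define q where "q = (\<lambda>t. if t = 0 then deriv E 0 else (E t - E 0) / t)"
  have q: "q holomorphic_on ball 0 r"
  proof (rule pole_theorem_open_0)
    show "(\<lambda>t. E t - E 0) holomorphic_on ball 0 r" by (intro holomorphic_intros E)
    have "E field_differentiable at 0"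
      using E r by (auto intro: holomorphic_on_imp_differentiable_at)
    then show "q 0 = deriv (\<lambda>t. E t - E 0) 0" by (simp add: q_def)
  qed (auto simp: q_def)
  have E_eq: "E t = E 0 + t * q t" for t by (simp add: q_def)
  have q': "(q has_field_derivative deriv q t) (at t)" if "t \<in> ball 0 r" for t
    using q that by (auto intro: holomorphic_derivI)
  have dE: "deriv E t = q t + t * deriv q t" if "t \<in> ball 0 r" for t
  proof (rule DERIV_imp_deriv)
    have "((\<lambda>t. E 0 + t * q t) has_field_derivative 0 + (1 * q t + deriv q t * t)) (at t)"
      by (intro DERIV_add DERIV_const DERIV_mult DERIV_ident q' that)
    then show "(E has_field_derivative q t + t * deriv q t) (at t)"
      unfolding E_eq[abs_def, symmetric] by (simp add: mult.commute)
  qed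
  have "deriv q holomorphic_on ball 0 r" by (intro holomorphic_deriv q) auto
  then have q'': "(deriv q has_field_derivative deriv (deriv q) 0) (at 0)"
    using r by (auto intro: holomorphic_derivI)
  have "((\<lambda>t. q t + t * deriv q t) has_field_derivative
      deriv q 0 + (1 * deriv q 0 + deriv (deriv q) 0 * 0)) (at 0)"
    by (intro DERIV_add DERIV_mult DERIV_ident q'' q') (use r in simp)
  then have "(deriv E has_field_derivative
      deriv q 0 + (1 * deriv q 0 + deriv (deriv q) 0 * 0)) (at 0)"
    by (rule has_field_derivative_transform_within_open[of _ _ _ "ball 0 r"]) (use r dE in auto)
  then have ddE: "deriv (deriv E) 0 = 2 * deriv q 0" by (simp add: DERIV_imp_deriv)
  have "((\<lambda>t. q (- t)) has_field_derivative deriv q 0 * (- 1)) (at 0)"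
    by (rule DERIV_chain2[where g = uminus]) (use q'[of 0] r in \<open>auto intro!: derivative_eq_intros\<close>)
  then have "((\<lambda>t. q t - q (- t)) has_field_derivative deriv q 0 - deriv q 0 * (- 1)) (at 0)"
    using q'[of 0] r by (intro DERIV_diff) auto
  then have "((\<lambda>t. (q t - q (- t)) / t) \<longlongrightarrow> 2 * deriv q 0) (at 0)"
    by (simp add: DERIV_def)
  moreover have "\<forall>\<^sub>F t in at 0. (q t - q (- t)) / t = (E t + E (- t) - 2 * E 0) / t\<^sup>2"
  proof (rule eventually_at_filter[THEN iffD2], rule always_eventually, intro allI impI)
    fix t :: complex assume "t \<noteq> 0"
    then show "(q t - q (- t)) / t = (E t + E (- t) - 2 * E 0) / t\<^sup>2"
      by (simp add: q_def field_simps power2_eq_square)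
  qed
  ultimately show ?thesis unfolding ddE by (rule Lim_transform_eventually)
qed

text \<open>The inverse of \<open>h\<close> applied to the midpoint of \<open>h (z * cis t)\<close> and \<open>h (z * cis (- t))\<close> is a self-map
  of the disc fixing \<open>0\<close>; the second-order expansion at \<open>t = 0\<close> of the Schwarz lemma yields the claim.\<close>

lemma convex_univalent_Re_nonneg:
  assumes h: "h holomorphic_on ball 0 1" "inj_on h (ball 0 1)" "convex (h ` ball 0 1)"
    and z: "z \<in> ball 0 1"
  shows "Re (1 + z * deriv (deriv h) z / deriv h z) \<ge> 0"
proof (cases "z = 0")
  case False
  have hz: "deriv h z \<noteq> 0" by (rule holomorphic_injective_imp_regular[OF h(1) open_ball h(2) z])
  obtain k where k: "k holomorphic_on h ` ball 0 1" "\<And>x. x \<in> ball 0 1 \<Longrightarrow> deriv h x * deriv k (h x) = 1"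
    "\<And>x. x \<in> ball 0 1 \<Longrightarrow> k (h x) = x"
    using holomorphic_has_inverse[OF h(1) open_ball h(2)] by metis
  have op: "open (h ` ball 0 1)" by (rule open_mapping_thm3[OF h(1) open_ball h(2)])
  have k_ball: "k y \<in> ball 0 1" if "y \<in> h ` ball 0 1" for y
    using that k(3) by auto
  define m where "m = (\<lambda>t::real. \<lambda>\<zeta>. (h (\<zeta> * cis t) + h (\<zeta> * cis (- t))) / 2)"
  have rot: "\<zeta> * cis t \<in> ball 0 1" if "\<zeta> \<in> ball 0 1" for \<zeta> t
    using that by (simp add: norm_mult)
  have m_in: "m t \<zeta> \<in> h ` ball 0 1" if "\<zeta> \<in> ball 0 1" for t \<zeta>
  proof -
    have "(1/2) *\<^sub>R h (\<zeta> * cis t) + (1/2) *\<^sub>R h (\<zeta> * cis (- t)) \<in> h ` ball 0 1"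
      by (rule convexD[OF h(3)]) (use rot[OF that] in auto)
    then show ?thesis unfolding m_def by (simp add: scaleR_conv_of_real add_divide_distrib)
  qed
  have Schwarz: "norm (k (m t z)) \<le> norm z" for t
  proof (rule Schwarz_Lemma(1)[of "\<lambda>\<zeta>. k (m t \<zeta>)" z])
    have rot_holo: "(\<lambda>\<zeta>. h (\<zeta> * cis s)) holomorphic_on ball 0 1" for s
      by (rule holomorphic_on_compose_gen[OF _ h(1), of "\<lambda>\<zeta>. \<zeta> * cis s", unfolded o_def])
        (use rot in \<open>auto intro!: holomorphic_intros\<close>)
    have "m t holomorphic_on ball 0 1" unfolding m_def by (intro holomorphic_intros rot_holo) auto
    then show "(\<lambda>\<zeta>. k (m t \<zeta>)) holomorphic_on ball 0 1"
      by (rule holomorphic_on_compose_gen[OF _ k(1), unfolded o_def]) (use m_in in auto)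
    show "k (m t 0) = 0" using k(3)[of 0] unfolding m_def by simp
    show "norm (k (m t \<zeta>)) < 1" if "norm \<zeta> < 1" for \<zeta>
      using k_ball[OF m_in[of \<zeta> t]] that by simp
  qed (use z in simp)
  \<comment> \<open>The rotation angle is made complex so that E is holomorphic near 0; real angles
    are restored when the limit is taken.\<close>
  define E where "E = (\<lambda>\<tau>. h (z * exp (\<i> * \<tau>)))"
  define T where "T = {\<tau>. norm (z * exp (\<i> * \<tau>)) < 1}"
  have "open T" unfolding T_def by (intro open_Collect_less continuous_intros)
  moreover have "0 \<in> T" using z unfolding T_def by simp
  ultimately obtain r where r: "r > 0" "ball 0 r \<subseteq> T" using openE by blast
  have in_ball: "z * exp (\<i> * \<tau>) \<in> ball 0 1" if "\<tau> \<in> ball 0 r" for \<tau>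
    using that r(2) unfolding T_def by auto
  have de: "((\<lambda>\<tau>. z * exp (\<i> * \<tau>)) has_field_derivative z * (\<i> * exp (\<i> * \<tau>))) (at \<tau>)" for \<tau>
    by (auto intro!: derivative_eq_intros)
  have dE: "(E has_field_derivative deriv h (z * exp (\<i> * \<tau>)) * (z * (\<i> * exp (\<i> * \<tau>)))) (at \<tau>)"
    if "\<tau> \<in> ball 0 r" for \<tau>
    unfolding E_def
    by (rule DERIV_chain2[where f = h, OF _ de]) (rule holomorphic_derivI[OF h(1) open_ball in_ball[OF that]])
  have "E holomorphic_on ball 0 r"
    unfolding holomorphic_on_open[OF open_ball] using dE by blast
  note lim = symmetric_second_difference_limit[OF this r(1)]
  have h': "deriv h holomorphic_on ball 0 1" by (intro holomorphic_deriv h) auto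
  have "((\<lambda>\<tau>. deriv h (z * exp (\<i> * \<tau>)) * (z * (\<i> * exp (\<i> * \<tau>)))) has_field_derivative
      (deriv (deriv h) (z * exp (\<i> * 0)) * (z * (\<i> * exp (\<i> * 0)))) * (z * (\<i> * exp (\<i> * 0))) +
      (z * (\<i> * (\<i> * exp (\<i> * 0)))) * deriv h (z * exp (\<i> * 0))) (at 0)"
  proof (intro DERIV_mult)
    show "((\<lambda>\<tau>. deriv h (z * exp (\<i> * \<tau>))) has_field_derivative
        deriv (deriv h) (z * exp (\<i> * 0)) * (z * (\<i> * exp (\<i> * 0)))) (at 0)"
      by (rule DERIV_chain2[where f = "deriv h", OF _ de])
        (rule holomorphic_derivI[OF h' open_ball in_ball], use r in simp)
    show "((\<lambda>\<tau>. z * (\<i> * exp (\<i> * \<tau>))) has_field_derivative z * (\<i> * (\<i> * exp (\<i> * 0)))) (at 0)"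
      by (auto intro!: derivative_eq_intros)
  qed
  then have "(deriv E has_field_derivative
      (deriv (deriv h) (z * exp (\<i> * 0)) * (z * (\<i> * exp (\<i> * 0)))) * (z * (\<i> * exp (\<i> * 0))) +
      (z * (\<i> * (\<i> * exp (\<i> * 0)))) * deriv h (z * exp (\<i> * 0))) (at 0)"
    by (rule has_field_derivative_transform_within_open[of _ _ _ "ball 0 r"])
      (use r DERIV_imp_deriv[OF dE] in auto)
  then have ddE: "deriv (deriv E) 0 = - (z\<^sup>2 * deriv (deriv h) z + z * deriv h z)"
    by (subst DERIV_imp_deriv, assumption) (simp add: power2_eq_square algebra_simps)
  have E0: "E 0 = h z" unfolding E_def by simp
  have mE: "m t z = (E (of_real t) + E (- of_real t)) / 2" for t
    unfolding m_def E_def cis_conv_exp by simp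
  have oftr: "filterlim complex_of_real (at 0) (at 0)"
    by (rule filterlim_atI) (auto intro!: tendsto_eq_intros simp: eventually_at_filter)
  have lim1: "((\<lambda>t::real. (E (of_real t) + E (- of_real t) - 2 * E 0) / (of_real t)\<^sup>2) \<longlongrightarrow> deriv (deriv E) 0) (at 0)"
    by (rule filterlim_compose[OF lim oftr])
  have "(k has_field_derivative deriv k (h z)) (at (h z))"
    using k(1) op z by (auto intro: holomorphic_derivI)
  \<comment> \<open>Caratheodory's form of the derivative, as \<open>m t z - h z\<close> might
    vanish and cannot be divided by.\<close>
  then obtain g where g: "\<And>y. k y - k (h z) = g y * (y - h z)" "isCont g (h z)" "g (h z) = deriv k (h z)"
    unfolding CARAT_DERIV by metis
  have "((\<lambda>t::real. m t z) \<longlongrightarrow> h z) (at 0)"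
  proof -
    have cE: "isCont E 0" using dE[of 0] r(1) by (auto intro: DERIV_isCont)
    have "((\<lambda>t::real. E (of_real t)) \<longlongrightarrow> E 0) (at 0)"
      by (rule isCont_tendsto_compose[OF cE]) (auto intro!: tendsto_eq_intros)
    moreover have "((\<lambda>t::real. E (- of_real t)) \<longlongrightarrow> E 0) (at 0)"
      by (rule isCont_tendsto_compose[OF cE]) (auto intro!: tendsto_eq_intros)
    ultimately have "((\<lambda>t::real. (E (of_real t) + E (- of_real t)) / 2) \<longlongrightarrow> (E 0 + E 0) / 2) (at 0)"
      by (intro tendsto_intros) auto
    then show ?thesis unfolding mE E0 by simp
  qed
  from isCont_tendsto_compose[OF g(2) this]
  have lim2: "((\<lambda>t. g (m t z)) \<longlongrightarrow> deriv k (h z)) (at 0)" unfolding g(3) .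
  \<comment> \<open>This expression is (k(m t z)/z - 1) / t^2 in disguise. Its real part is at most
    0 by the Schwarz bound, and its limit will turn out to be -(1 + z h''/h') / 2.\<close>
  have "((\<lambda>t::real. g (m t z) * ((E (of_real t) + E (- of_real t) - 2 * E 0) / (of_real t)\<^sup>2) / (2 * z))
      \<longlongrightarrow> deriv k (h z) * deriv (deriv E) 0 / (2 * z)) (at 0)"
    by (intro tendsto_intros lim1 lim2) (use False in simp)
  moreover have "g (m t z) * ((E (of_real t) + E (- of_real t) - 2 * E 0) / (of_real t)\<^sup>2) / (2 * z)
      = (k (m t z) / z - 1) / of_real (t\<^sup>2)" for t :: real
  proof -
    define d where "d = m t z - h z"
    have "E (of_real t) + E (- of_real t) - 2 * E 0 = 2 * d"
      unfolding d_def mE E0 by simp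
    then have "g (m t z) * ((E (of_real t) + E (- of_real t) - 2 * E 0) / (of_real t)\<^sup>2) / (2 * z)
      = (g (m t z) * d) / (of_real t)\<^sup>2 / z" by simp
    also have "\<dots> = (k (m t z) - z) / (of_real t)\<^sup>2 / z"
      using g(1)[of "m t z"] k(3)[OF z] unfolding d_def by simp
    also have "\<dots> = (k (m t z) / z - 1) / of_real (t\<^sup>2)" using False by (simp add: field_simps)
    finally show ?thesis .
  qed
  ultimately have "((\<lambda>t. (k (m t z) / z - 1) / of_real (t\<^sup>2)) \<longlongrightarrow> deriv k (h z) * deriv (deriv E) 0 / (2 * z)) (at 0)"
    by simp
  then have "((\<lambda>t. Re ((k (m t z) / z - 1) / of_real (t\<^sup>2))) \<longlongrightarrow> Re (deriv k (h z) * deriv (deriv E) 0 / (2 * z))) (at 0)"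
    by (rule tendsto_Re)
  moreover have "Re ((k (m t z) / z - 1) / of_real (t\<^sup>2)) \<le> 0" for t
  proof -
    have "Re (k (m t z) / z) \<le> norm (k (m t z) / z)" by (rule complex_Re_le_cmod)
    also have "\<dots> \<le> 1" using Schwarz[of t] False by (simp add: norm_divide)
    finally show ?thesis unfolding Re_divide_of_real by (simp add: divide_nonpos_nonneg)
  qed
  ultimately have le: "Re (deriv k (h z) * deriv (deriv E) 0 / (2 * z)) \<le> 0"
    by (intro tendsto_upperbound[of _ _ "at (0::real)"] always_eventually) auto
  have "deriv k (h z) = 1 / deriv h z" using k(2)[OF z] hz by (simp add: field_simps)
  then have "deriv k (h z) * deriv (deriv E) 0 / (2 * z) = - (1 + z * deriv (deriv h) z / deriv h z) / 2"
    unfolding ddE using False hz by (simp add: field_simps power2_eq_square)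
  with le show ?thesis by simp
qed simp

section \<open>The Schwarz lemma and Harnack's inequality under threefold symmetry\<close>

lemma Schwarz_factor:
  assumes f: "f holomorphic_on ball 0 1" "f 0 = 0" and le: "\<And>z. norm z < 1 \<Longrightarrow> norm (f z) \<le> 1"
  obtains g where "g holomorphic_on ball 0 1" "\<And>z. norm z < 1 \<Longrightarrow> f z = z * g z"
    "\<And>z. norm z < 1 \<Longrightarrow> norm (g z) \<le> 1"
proof -
  obtain g where g: "g holomorphic_on ball 0 1" "\<And>z. norm z < 1 \<Longrightarrow> f z = z * g z" "deriv f 0 = g 0"
    using Schwarz3[OF f] by metis
  \<comment> \<open>The bound on f is non-strict so that factoring can be repeated even when a
    quotient is a unimodular constant. Scaling by c < 1 gives the strict bound of the Schwarz lemma;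
    then c tends to 1.\<close>
  have scaled: "c * norm (f z) \<le> norm z \<and> c * norm (deriv f 0) \<le> 1" if c: "0 < c" "c < 1" and z: "norm z < 1" for c z
  proof -
    let ?F = "\<lambda>z. of_real c * f z"
    have F: "?F holomorphic_on ball 0 1" "?F 0 = 0" using f by (auto intro!: holomorphic_intros)
    have lt: "norm (?F w) < 1" if "norm w < 1" for w
    proof -
      have "c * norm (f w) \<le> c * 1" using le[OF that] c by (intro mult_left_mono) auto
      also have "\<dots> < 1" using c by simp
      finally show ?thesis using c by (simp add: norm_mult)
    qed
    have "deriv ?F 0 = of_real c * deriv f 0"
      using f(1) by (intro deriv_cmult holomorphic_on_imp_differentiable_at[of _ "ball 0 1"]) auto
    then show ?thesis
      using Schwarz_Lemma(1)[OF F lt z] Schwarz_Lemma(2)[OF F lt z] c by (simp add: norm_mult)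
  qed
  have limit: "x \<le> y" if "\<And>c. 0 < c \<Longrightarrow> c < 1 \<Longrightarrow> c * x \<le> y" for x y :: real
    by (rule field_le_mult_one_interval[of x y]) (use that in auto)
  have "norm (g z) \<le> 1" if z: "norm z < 1" for z
  proof (cases "z = 0")
    case True
    then show ?thesis using limit[of "norm (deriv f 0)" 1] scaled[OF _ _ z] g(3) by simp
  next
    case False
    have "norm (f z) \<le> norm z" using limit[of "norm (f z)" "norm z"] scaled[OF _ _ z] by simp
    then show ?thesis using g(2)[OF z] False by (simp add: norm_mult)
  qed
  then show ?thesis using that g by blast
qed

text \<open>Both sides are compared as z tends to 0. The relation is assumed off 0 only, because it
  will arise by cancelling z.\<close>

lemma rotation_equivariant_imp_zero:
  fixes F :: "complex \<Rightarrow> complex"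
  assumes F: "F holomorphic_on ball 0 1" and w: "norm \<omega> = 1"
    and eq: "\<And>z. norm z < 1 \<Longrightarrow> z \<noteq> 0 \<Longrightarrow> c * F (\<omega> * z) = F z" and c: "c \<noteq> 1"
  shows "F 0 = 0"
proof -
  have cF: "isCont F 0"
    using holomorphic_on_imp_continuous_on[OF F] by (simp add: continuous_on_eq_continuous_at)
  have "((\<lambda>z. c * F (\<omega> * z)) \<longlongrightarrow> c * F 0) (at 0)"
    by (intro tendsto_intros isCont_tendsto_compose[OF cF]) (auto intro!: tendsto_eq_intros)
  moreover have "\<forall>\<^sub>F z in at 0. c * F (\<omega> * z) = F z"
    unfolding eventually_at using eq by (intro exI[of _ 1]) auto
  ultimately have "(F \<longlongrightarrow> c * F 0) (at 0)" by (rule Lim_transform_eventually)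
  moreover have "(F \<longlongrightarrow> F 0) (at 0)" using cF by (simp add: isCont_def)
  ultimately have "c * F 0 = F 0" by (intro tendsto_unique) auto
  then show ?thesis using c by auto
qed

text \<open>Invariance under a primitive cube root of unity leaves only powers of z^3. Each division
  by z multiplies the equivariance factor by omega; as omega and omega^2 differ from 1, the first
  two quotients vanish at 0, and z divides out three times.\<close>

lemma threefold_Schwarz:
  assumes f: "f holomorphic_on ball 0 1" "f 0 = 0" and le: "\<And>z. norm z < 1 \<Longrightarrow> norm (f z) \<le> 1"
    and w: "\<omega> ^ 3 = 1" "\<omega> \<noteq> 1" and sym: "\<And>z. norm z < 1 \<Longrightarrow> f (\<omega> * z) = f z"
    and z: "norm z < 1"
  shows "norm (f z) \<le> norm z ^ 3"
proof -
  have nw: "norm \<omega> = 1" using w(1) by (metis norm_one norm_power power_eq_1_iff norm_ge_zero zero_neq_numeral)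
  then have w0: "\<omega> \<noteq> 0" by auto
  have w2: "\<omega>\<^sup>2 \<noteq> 1" using w by (auto simp: power3_eq_cube power2_eq_square)
  have rot: "norm (\<omega> * z) < 1" if "norm z < 1" for z using that nw by (simp add: norm_mult)
  obtain g1 where g1: "g1 holomorphic_on ball 0 1" "\<And>z. norm z < 1 \<Longrightarrow> f z = z * g1 z"
    "\<And>z. norm z < 1 \<Longrightarrow> norm (g1 z) \<le> 1" using Schwarz_factor[OF f le] by metis
  have s1: "\<omega> * g1 (\<omega> * z) = g1 z" if "norm z < 1" "z \<noteq> 0" for z
    using sym[OF that(1)] g1(2)[OF that(1)] g1(2)[OF rot[OF that(1)]] that(2) by simp
  have "g1 0 = 0" by (rule rotation_equivariant_imp_zero[OF g1(1) nw s1 w(2)])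
  then obtain g2 where g2: "g2 holomorphic_on ball 0 1" "\<And>z. norm z < 1 \<Longrightarrow> g1 z = z * g2 z"
    "\<And>z. norm z < 1 \<Longrightarrow> norm (g2 z) \<le> 1" using Schwarz_factor[OF g1(1) _ g1(3)] by metis
  have s2: "\<omega>\<^sup>2 * g2 (\<omega> * z) = g2 z" if "norm z < 1" "z \<noteq> 0" for z
    using s1[OF that] g2(2)[OF that(1)] g2(2)[OF rot[OF that(1)]] that(2)
    by (simp add: power2_eq_square mult.assoc)
  have "g2 0 = 0" by (rule rotation_equivariant_imp_zero[OF g2(1) nw s2 w2])
  then obtain g3 where g3: "\<And>z. norm z < 1 \<Longrightarrow> g2 z = z * g3 z"
    "\<And>z. norm z < 1 \<Longrightarrow> norm (g3 z) \<le> 1" using Schwarz_factor[OF g2(1) _ g2(3)] by metis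
  have "f z = z ^ 3 * g3 z" using g1(2) g2(2) g3(1) z by (simp add: power3_eq_cube)
  then have "norm (f z) = norm z ^ 3 * norm (g3 z)" by (simp add: norm_mult norm_power)
  also have "\<dots> \<le> norm z ^ 3 * 1" using g3(2)[OF z] by (intro mult_left_mono) auto
  finally show ?thesis by simp
qed

text \<open>The Cayley transform of P inherits the symmetry and vanishes at 0, so its modulus is at
  most |z|^3. The result is the lower Harnack bound with |z|^3 in place of |z|.\<close>

lemma threefold_Harnack:
  assumes P: "P holomorphic_on ball 0 1" "P 0 = 1" and nonneg: "\<And>z. norm z < 1 \<Longrightarrow> Re (P z) \<ge> 0"
    and w: "\<omega> ^ 3 = 1" "\<omega> \<noteq> 1" and sym: "\<And>z. norm z < 1 \<Longrightarrow> P (\<omega> * z) = P z"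
    and z: "norm z < 1"
  shows "Re (P z) - 1 \<ge> - 2 * norm z ^ 3 / (1 + norm z ^ 3)"
proof -
  have nz: "P z + 1 \<noteq> 0" if "norm z < 1" for z
  proof
    assume "P z + 1 = 0"
    then have "Re (P z) = - 1" by (simp add: complex_eq_iff)
    then show False using nonneg[OF that] by simp
  qed
  define M where "M = (\<lambda>z. (P z - 1) / (P z + 1))"
  have "norm (M z) \<le> norm z ^ 3"
  proof (rule threefold_Schwarz[OF _ _ _ w _ z])
    show "M holomorphic_on ball 0 1" unfolding M_def using nz by (intro holomorphic_intros P) auto
    show "M 0 = 0" unfolding M_def using P by simp
    show "M (\<omega> * z) = M z" if "norm z < 1" for z unfolding M_def sym[OF that] ..
    show "norm (M z) \<le> 1" if "norm z < 1" for z
    proof -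
      have "(norm (P z - 1))\<^sup>2 \<le> (norm (P z + 1))\<^sup>2"
        unfolding cmod_power2 using nonneg[OF that] by (simp add: power2_eq_square algebra_simps)
      then have "norm (P z - 1) \<le> norm (P z + 1)" by (rule power2_le_imp_le) simp
      then show ?thesis unfolding M_def using nz[OF that] by (simp add: norm_divide)
    qed
  qed
  define q where "q = norm z ^ 3"
  have q: "0 \<le> q" "q < 1" unfolding q_def using z by (auto simp: power_less_one_iff)
  define m where "m = norm (M z)"
  have m: "0 \<le> m" "m \<le> q" using \<open>norm (M z) \<le> norm z ^ 3\<close> unfolding m_def q_def by auto
  have nM: "1 - M z \<noteq> 0" using m q unfolding m_def by auto
  have "P z * (1 - M z) = 1 + M z" unfolding M_def using nz[OF z] by (simp add: field_simps)
  then have Pz: "P z = (1 + M z) / (1 - M z)" using nM by (simp add: field_simps)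
  have "Re (P z) = (1 - m\<^sup>2) / (norm (1 - M z))\<^sup>2"
  proof -
    have "P z = (1 + M z) * cnj (1 - M z) / of_real ((norm (1 - M z))\<^sup>2)"
      unfolding Pz by (subst complex_div_cnj) simp
    then have "Re (P z) = Re ((1 + M z) * cnj (1 - M z)) / (norm (1 - M z))\<^sup>2"
      by (simp only: Re_divide_of_real)
    also have "Re ((1 + M z) * cnj (1 - M z)) = 1 - m\<^sup>2"
      unfolding m_def cmod_power2 by (simp add: algebra_simps power2_eq_square)
    finally show ?thesis .
  qed
  also have "\<dots> \<ge> (1 - m\<^sup>2) / (1 + m)\<^sup>2"
  proof (rule divide_left_mono)
    have "norm (1 - M z) \<le> 1 + m" unfolding m_def using norm_triangle_ineq4[of 1 "M z"] by simp
    then show "(norm (1 - M z))\<^sup>2 \<le> (1 + m)\<^sup>2" by (intro power_mono) auto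
    show "0 \<le> 1 - m\<^sup>2" using m q by (simp add: abs_square_le_1)
    show "0 < (1 + m)\<^sup>2 * (norm (1 - M z))\<^sup>2" using nM m by simp
  qed
  also have "(1 - m\<^sup>2) / (1 + m)\<^sup>2 = (1 - m) / (1 + m)"
  proof -
    have "1 - m\<^sup>2 = (1 - m) * (1 + m)" by (simp add: power2_eq_square algebra_simps)
    then show ?thesis using m by (simp add: power2_eq_square)
  qed
  finally have "Re (P z) \<ge> (1 - m) / (1 + m)" .
  moreover have "(1 - m) / (1 + m) \<ge> (1 - q) / (1 + q)"
    using m q by (simp add: frac_le)
  moreover have "(1 - q) / (1 + q) = 1 - 2 * q / (1 + q)" using q by (simp add: field_simps)
  ultimately show ?thesis unfolding q_def by simp
qed

lemma Re_along_ray_has_derivative: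
  assumes l: "(l has_field_derivative D) (at (of_real t * v))"
  shows "((\<lambda>t::real. Re (l (of_real t * v))) has_real_derivative Re (v * D)) (at t)"
proof -
  have "((\<lambda>t::real. of_real t * v) has_vector_derivative v) (at t)"
    by (auto intro!: derivative_eq_intros simp: scaleR_conv_of_real)
  from field_vector_diff_chain_at[OF this l]
  have "((\<lambda>t::real. l (of_real t * v)) has_vector_derivative v * D) (at t)" by (simp add: o_def)
  from bounded_linear.has_vector_derivative[OF bounded_linear_Re this]
  show ?thesis by (simp add: has_real_derivative_iff_has_vector_derivative)
qed

text \<open>Let P be the average of 1 + z h''/h' over the three rotations. The logarithmic
  derivative in t of the product of the three |h'| is 3 (Re P - 1) / t, which Harnack bounds below
  by -6 t^2 / (1 + t^3); integration produces (1 + r^3)^2.\<close>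

lemma convex_univalent_deriv_product:
  assumes h: "h holomorphic_on ball 0 1" "inj_on h (ball 0 1)" "convex (h ` ball 0 1)"
    and w: "\<omega> ^ 3 = 1" "\<omega> \<noteq> 1" and u: "norm u = 1" and r: "0 \<le> r" "r < 1"
  shows "norm (deriv h 0) ^ 3 \<le> norm (deriv h (of_real r * u)) * norm (deriv h (of_real r * (\<omega> * u))) *
    norm (deriv h (of_real r * (\<omega>\<^sup>2 * u))) * (1 + r ^ 3)\<^sup>2"
proof -
  have nw: "norm \<omega> = 1" using w(1) by (metis norm_one norm_power power_eq_1_iff norm_ge_zero zero_neq_numeral)
  have h': "deriv h holomorphic_on ball 0 1" by (intro holomorphic_deriv h) auto
  have nz: "deriv h z \<noteq> 0" if "z \<in> ball 0 1" for z
    by (rule holomorphic_injective_imp_regular[OF h(1) open_ball h(2) that])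
  obtain l where l: "l holomorphic_on ball 0 1" "\<And>z. z \<in> ball 0 1 \<Longrightarrow> exp (l z) = deriv h z"
    using holomorphic_logarithm_exists[OF convex_ball open_ball h' nz, of 0] by auto
  have l': "deriv l holomorphic_on ball 0 1" by (intro holomorphic_deriv l) auto
  have dl: "(l has_field_derivative deriv l z) (at z)" if "z \<in> ball 0 1" for z
    using l(1) that by (auto intro: holomorphic_derivI)
  have log_deriv: "deriv (deriv h) z / deriv h z = deriv l z" if z: "z \<in> ball 0 1" for z
  proof -
    have "((\<lambda>z. exp (l z)) has_field_derivative exp (l z) * deriv l z) (at z)"
      by (rule DERIV_chain2[where f = exp, OF DERIV_exp dl[OF z]])
    then have "(deriv h has_field_derivative exp (l z) * deriv l z) (at z)"
      by (rule has_field_derivative_transform_within_open[of _ _ _ "ball 0 1"]) (use z l(2) in auto)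
    then have "deriv (deriv h) z = exp (l z) * deriv l z" by (rule DERIV_imp_deriv)
    then show ?thesis using nz[OF z] l(2)[OF z] by simp
  qed
  define Q where "Q = (\<lambda>z. z * deriv l z)"
  have Q: "Q holomorphic_on ball 0 1" unfolding Q_def by (intro holomorphic_intros l')
  have Q_Re: "Re (1 + Q z) \<ge> 0" if "z \<in> ball 0 1" for z
    using convex_univalent_Re_nonneg[OF h that] log_deriv[OF that] unfolding Q_def
    by (simp flip: times_divide_eq_right)
  have rot1: "\<omega> * z \<in> ball 0 1" and rot2: "\<omega>\<^sup>2 * z \<in> ball 0 1" if "z \<in> ball 0 1" for z
    using that nw by (auto simp: norm_mult norm_power)
  define P where "P = (\<lambda>z. 1 + (Q z + Q (\<omega> * z) + Q (\<omega>\<^sup>2 * z)) / 3)"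
  have Qc: "(\<lambda>z. Q (c * z)) holomorphic_on ball 0 1" if "\<And>z. z \<in> ball 0 1 \<Longrightarrow> c * z \<in> ball 0 1" for c
    by (rule holomorphic_on_compose_gen[OF _ Q, of "\<lambda>z. c * z", unfolded o_def])
      (use that in \<open>auto intro!: holomorphic_intros\<close>)
  have Harnack: "Re (P z) - 1 \<ge> - 2 * norm z ^ 3 / (1 + norm z ^ 3)" if z: "norm z < 1" for z
  proof (rule threefold_Harnack[OF _ _ _ w _ z])
    show "P holomorphic_on ball 0 1"
      unfolding P_def by (intro holomorphic_intros Q Qc rot1 rot2) auto
    show "P 0 = 1" unfolding P_def Q_def by simp
    show "Re (P z) \<ge> 0" if "norm z < 1" for z
    proof -
      have "Re (P z) = (Re (1 + Q z) + Re (1 + Q (\<omega> * z)) + Re (1 + Q (\<omega>\<^sup>2 * z))) / 3"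
        unfolding P_def by simp
      then show ?thesis
        using Q_Re[of z] Q_Re[OF rot1[of z]] Q_Re[OF rot2[of z]] that by simp
    qed
    show "P (\<omega> * z) = P z" if "norm z < 1" for z
    proof -
      have 1: "\<omega> * (\<omega> * z) = \<omega>\<^sup>2 * z" by (simp add: power2_eq_square)
      have "\<omega>\<^sup>2 * (\<omega> * z) = \<omega> ^ 3 * z" by (simp add: power2_eq_square power3_eq_cube)
      then have 2: "\<omega>\<^sup>2 * (\<omega> * z) = z" using w(1) by simp
      show ?thesis unfolding P_def 1 2 by (simp add: add.commute)
    qed
  qed
  \<comment> \<open>The logarithm of the product plus the term 2 ln (1 + t^3), whose derivative
    exactly offsets the Harnack bound, so that X is nondecreasing.\<close>
  define X where "X = (\<lambda>t::real. Re (l (of_real t * u)) + Re (l (of_real t * (\<omega> * u))) +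
      Re (l (of_real t * (\<omega>\<^sup>2 * u))) + 2 * ln (1 + t ^ 3))"
  have mem: "of_real t * u \<in> ball 0 1" "of_real t * (\<omega> * u) \<in> ball 0 1" "of_real t * (\<omega>\<^sup>2 * u) \<in> ball 0 1"
    if "0 \<le> t" "t < 1" for t
    using that u nw by (auto simp: norm_mult norm_power)
  have dX: "(X has_real_derivative (Re (u * deriv l (of_real t * u)) +
      Re ((\<omega> * u) * deriv l (of_real t * (\<omega> * u))) +
      Re ((\<omega>\<^sup>2 * u) * deriv l (of_real t * (\<omega>\<^sup>2 * u))) + 2 * (3 * t\<^sup>2 / (1 + t ^ 3)))) (at t)"
    if t: "0 \<le> t" "t < 1" for t
    unfolding X_def
  proof (intro DERIV_add Re_along_ray_has_derivative dl mem t)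
    have "1 + t ^ 3 > 0" using t by (simp add: add_pos_nonneg)
    then show "((\<lambda>t. 2 * ln (1 + t ^ 3)) has_real_derivative 2 * (3 * t\<^sup>2 / (1 + t ^ 3))) (at t)"
      by (auto intro!: derivative_eq_intros)
  qed
  have "X 0 \<le> X r"
  proof (rule DERIV_nonneg_imp_increasing_open[OF r(1)])
    show "continuous_on {0..r} X"
      by (intro continuous_at_imp_continuous_on ballI, rule DERIV_isCont[OF dX]) (use r in auto)
    fix t assume t: "0 < t" "t < r"
    then have t': "0 \<le> t" "t < 1" using r by auto
    define S where "S = Re (u * deriv l (of_real t * u)) + Re ((\<omega> * u) * deriv l (of_real t * (\<omega> * u))) +
      Re ((\<omega>\<^sup>2 * u) * deriv l (of_real t * (\<omega>\<^sup>2 * u)))"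
    have nt: "norm (of_real t * u) = t" using u t by (simp add: norm_mult)
    have arg: "\<omega> * (of_real t * u) = of_real t * (\<omega> * u)" "\<omega>\<^sup>2 * (of_real t * u) = of_real t * (\<omega>\<^sup>2 * u)"
      by simp_all
    have "Re (Q (of_real t * v)) = t * Re (v * deriv l (of_real t * v))" for v
      unfolding Q_def mult.assoc by simp
    then have P_eq: "Re (P (of_real t * u)) - 1 = t * S / 3"
      unfolding P_def arg S_def by (simp add: distrib_left)
    have eq: "- 2 * t ^ 3 / q = t * (- 6 * t\<^sup>2 / q) / 3" for q
      by (cases "q = 0") (simp_all add: field_simps power2_eq_square power3_eq_cube)
    have "- 2 * t ^ 3 / (1 + t ^ 3) \<le> Re (P (of_real t * u)) - 1"
      using Harnack[of "of_real t * u"] t' unfolding nt by blast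
    then have "t * (- 6 * t\<^sup>2 / (1 + t ^ 3)) / 3 \<le> t * S / 3"
      unfolding P_eq eq[of "1 + t ^ 3"] .
    then have "t * (- 6 * t\<^sup>2 / (1 + t ^ 3)) \<le> t * S"
      unfolding divide_le_cancel by simp
    then have "- 6 * t\<^sup>2 / (1 + t ^ 3) \<le> S" using t by (simp only: mult_le_cancel_left_pos)
    then have "S + 2 * (3 * t\<^sup>2 / (1 + t ^ 3)) \<ge> 0" by simp
    then show "\<exists>y. (X has_real_derivative y) (at t) \<and> 0 \<le> y"
      using dX[OF t'] unfolding S_def by blast
  qed
  then have "exp (X 0) \<le> exp (X r)" by simp
  moreover have "norm (deriv h 0) = exp (Re (l 0))"
    using l(2)[of 0] norm_exp_eq_Re[of "l 0"] by simp
  then have "exp (X 0) = norm (deriv h 0) ^ 3"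
    unfolding X_def by (simp add: power3_eq_cube flip: exp_add)
  moreover have "exp (X r) = norm (deriv h (of_real r * u)) * norm (deriv h (of_real r * (\<omega> * u))) *
    norm (deriv h (of_real r * (\<omega>\<^sup>2 * u))) * (1 + r ^ 3)\<^sup>2"
  proof -
    have "1 + r ^ 3 > 0" using r by (simp add: add_pos_nonneg)
    then have "exp (2 * ln (1 + r ^ 3)) = (1 + r ^ 3)\<^sup>2" by (simp add: exp_double)
    then show ?thesis
      unfolding X_def exp_add norm_exp_eq_Re[symmetric] l(2)[OF mem(1)[OF r]] l(2)[OF mem(2)[OF r]]
        l(2)[OF mem(3)[OF r]] by simp
  qed
  ultimately show ?thesis by simp
qed

subsection \<open>The lower bounds\<close>

lemma Moebius_disc_automorphism:
  assumes p: "norm p < 1"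
  defines "F \<equiv> Moebius_function 0 (- p)"
  shows "F holomorphic_on ball 0 1" "inj_on F (ball 0 1)" "F ` ball 0 1 = ball 0 1" "F 0 = p"
    "deriv F 0 = of_real (1 - (norm p)\<^sup>2)"
proof -
  let ?H = "Moebius_function 0 p"
  have p': "norm (- p) < 1" using p by simp
  show "F holomorphic_on ball 0 1" unfolding F_def by (rule Moebius_function_holomorphic[OF p'])
  have HF: "?H (F z) = z" if "norm z < 1" for z
    unfolding F_def by (rule Moebius_function_compose) (use that p in auto)
  have FH: "F (?H z) = z" if "norm z < 1" for z
    unfolding F_def by (rule Moebius_function_compose) (use that p in auto)
  show "inj_on F (ball 0 1)" by (rule inj_on_inverseI[of _ ?H]) (use HF in auto)
  have "F z \<in> ball 0 1" "?H z \<in> ball 0 1" if "z \<in> ball 0 1" for z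
    using Moebius_function_norm_lt_1 p p' that unfolding F_def by auto
  then show "F ` ball 0 1 = ball 0 1" using FH by (force intro: image_eqI[of _ F "?H _"])
  show "F 0 = p" unfolding F_def Moebius_function_simple by simp
  have "(F has_field_derivative ((1 - 0) * (1 - cnj (- p) * 0) - (0 - (- p)) * (0 - cnj (- p) * 1)) /
      ((1 - cnj (- p) * 0) * (1 - cnj (- p) * 0))) (at 0)"
    unfolding F_def Moebius_function_simple by (rule derivative_eq_intros refl | simp)+
  then show "deriv F 0 = of_real (1 - (norm p)\<^sup>2)"
    unfolding of_real_diff complex_norm_square by (subst DERIV_imp_deriv, assumption) simp
qed

lemma finite_blaschke_product_slit_lift:
  assumes n: "n \<ge> 1" and a: "\<forall>j\<in>{1..n}. norm (a j) < 1" and p: "norm p < 1"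
    and reg: "\<And>z. z \<in> ball 0 1 \<Longrightarrow> blaschke_product n a z = p \<Longrightarrow> deriv (blaschke_product n a) z \<noteq> 0"
  obtains u G where "norm u = 1" "disc_lift.is_lift (blaschke_product n a) (Moebius_function 0 (- p)) (slit_disc u) G"
proof -
  let ?b = "blaschke_product n a" and ?F = "Moebius_function 0 (- p)"
  obtain R where "circle_self_map ?b R" using blaschke_product_circle_self_map[OF n a] .
  then interpret b: circle_self_map ?b R .
  note F = Moebius_disc_automorphism[OF p]
  interpret disc_lift ?b ?F
  proof
    show "?b holomorphic_on ball 0 1"
      by (rule holomorphic_on_subset[OF b.holo subset_ball]) (use b.R in simp)
    show "?F holomorphic_on ball 0 1" "inj_on ?F (ball 0 1)" by (rule F)+
    show "?F ` ball 0 1 \<subseteq> ball 0 1" using F(3) by simp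
    show "\<exists>\<rho>'<1. \<forall>z\<in>ball 0 1. norm (?b z) \<le> \<rho> \<longrightarrow> norm z \<le> \<rho>'" if "\<rho> < 1" for \<rho>
      by (rule b.proper[OF that])
  qed
  let ?Z = "{z \<in> ball 0 1. ?b z = p}"
  have count: "finite ?Z" "(\<Sum>c\<in>b.crit. nat (zorder (deriv ?b) c)) < card ?Z"
    using b.crit_count[OF p reg] by auto
  show ?thesis
  proof (rule slit_disc_lift[of ?Z b.crit "\<lambda>c. nat (zorder (deriv ?b) c)"])
    show "finite ?Z" "(\<Sum>c\<in>b.crit. nat (zorder (deriv ?b) c)) < card ?Z" by (rule count)+
    show "?Z \<noteq> {}"
    proof
      assume "?Z = {}"
      with count(2) show False by (simp only: card.empty not_less_zero)
    qed
    show "z \<in> ball 0 1 \<and> ?b z = ?F 0 \<and> deriv ?b z \<noteq> 0" if "z \<in> ?Z" for z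
      using that reg F(4) by auto
    show "finite b.crit" by (rule b.finite_crit)
    show "b.crit = {c \<in> ball 0 1. deriv ?b c = 0}" by (rule b.crit_def)
    show "1 \<le> nat (zorder (deriv ?b) c)" if "c \<in> b.crit" for c by (rule b.crit_order_pos[OF that])
    show "\<exists>h r. r > 0 \<and> inj_on h (ball c r) \<and>
        (\<forall>z\<in>ball c r. ?b z - ?b c = h z ^ Suc (nat (zorder (deriv ?b) c)))" if "c \<in> b.crit" for c
      by (rule b.crit_power_form) (use that in \<open>simp add: b.crit_def\<close>)
  qed (rule that)
qed

text \<open>For the lift G one has f o F = (f o B) o G on the slit disc. The chain rule and
  Schwarz-Pick for G turn |(f o F)'| at w times the conformal radius into at most |(f o B)'(z)| (1 -
  |z|^2) at z = G w.\<close>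

lemma bloch_seminorm_blaschke_lower_bound:
  assumes f: "f holomorphic_on ball 0 1" "deriv f 0 = 1" and B: "finite_blaschke_product B" and \<epsilon>: "\<epsilon> > 0"
  obtains p u where "norm p < 1" "norm u = 1"
    "norm (deriv (f \<circ> Moebius_function 0 (- p)) 0) > 1 - \<epsilon>"
    "\<forall>s. Re s > 0 \<longrightarrow> norm s < 1 \<longrightarrow>
       ereal (norm (deriv (f \<circ> Moebius_function 0 (- p)) (u * s\<^sup>2)) * slit_radius s) \<le> bloch_seminorm (f \<circ> B)"
proof -
  obtain n a where n: "n \<ge> 1" and a: "\<forall>j\<in>{1..n}. norm (a j) < 1"
    and B_eq: "\<And>z. z \<in> ball 0 1 \<Longrightarrow> B z = blaschke_product n a z"
    using B unfolding finite_blaschke_product_def blaschke_product_def by metis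
  let ?b = "blaschke_product n a"
  obtain R where "circle_self_map ?b R" using blaschke_product_circle_self_map[OF n a] .
  then interpret b: circle_self_map ?b R .
  have f': "deriv f holomorphic_on ball 0 1" by (intro holomorphic_deriv f) auto
  have "isCont (\<lambda>p. norm (deriv f p) * (1 - (norm p)\<^sup>2)) 0"
    using holomorphic_on_imp_continuous_on[OF f']
    by (intro continuous_intros) (simp add: continuous_on_eq_continuous_at)
  then have "((\<lambda>p. norm (deriv f p) * (1 - (norm p)\<^sup>2)) \<longlongrightarrow> 1) (at 0)"
    using f(2) by (simp add: isCont_def)
  then have "\<forall>\<^sub>F p in at 0. norm (deriv f p) * (1 - (norm p)\<^sup>2) > 1 - \<epsilon>"
    using \<epsilon> by (intro order_tendstoD) auto
  \<comment> \<open>Critical values are finite in number, but 0 may be one of them; it is exempted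
    here to have a neighbourhood of 0 and excluded by p being nonzero.\<close>
  moreover have "\<forall>\<^sub>F p in at 0. p \<in> ball 0 1 - (?b ` b.crit - {0})"
    by (rule eventually_at_in_open') (use b.finite_crit in \<open>auto intro!: open_Diff finite_imp_closed\<close>)
  moreover have "\<forall>\<^sub>F p in at 0. p \<noteq> (0::complex)" by (rule eventually_neq_at_within)
  ultimately have "\<forall>\<^sub>F p in at 0. p \<in> ball 0 1 \<and> p \<notin> ?b ` b.crit \<and> norm (deriv f p) * (1 - (norm p)\<^sup>2) > 1 - \<epsilon>"
    by eventually_elim auto
  then obtain p where p: "norm p < 1" "p \<notin> ?b ` b.crit" "norm (deriv f p) * (1 - (norm p)\<^sup>2) > 1 - \<epsilon>"
    using eventually_happens'[of "at (0::complex)"] by auto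
  let ?F = "Moebius_function 0 (- p)"
  note F = Moebius_disc_automorphism[OF p(1)]
  obtain u G where u: "norm u = 1" and G: "disc_lift.is_lift ?b ?F (slit_disc u) G"
  proof (rule finite_blaschke_product_slit_lift[OF n a p(1)])
    show "deriv ?b z \<noteq> 0" if "z \<in> ball 0 1" "?b z = p" for z
      using p(2) that unfolding b.crit_def by auto
  qed
  interpret disc_lift ?b ?F
  proof
    show "?b holomorphic_on ball 0 1"
      by (rule holomorphic_on_subset[OF b.holo subset_ball]) (use b.R in simp)
    show "?F holomorphic_on ball 0 1" "inj_on ?F (ball 0 1)" by (rule F)+
    show "?F ` ball 0 1 \<subseteq> ball 0 1" using F(3) by simp
    show "\<exists>\<rho>'<1. \<forall>z\<in>ball 0 1. norm (?b z) \<le> \<rho> \<longrightarrow> norm z \<le> \<rho>'" if "\<rho> < 1" for \<rho>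
      by (rule b.proper[OF that])
  qed
  have G': "open (slit_disc u)" "G holomorphic_on slit_disc u" "G ` slit_disc u \<subseteq> ball 0 1"
    "\<And>w. w \<in> slit_disc u \<Longrightarrow> ?b (G w) = ?F w" "slit_disc u \<subseteq> ball 0 1"
    using G unfolding is_lift_def by auto
  have diff: "g field_differentiable at z" if "g holomorphic_on ball 0 1" "z \<in> ball 0 1" for g z
    using that by (auto intro: holomorphic_on_imp_differentiable_at)
  show ?thesis
  proof (rule that[OF p(1) u])
    have "deriv (f \<circ> ?F) 0 = deriv f (?F 0) * deriv ?F 0"
      by (rule deriv_chain) (use diff f F p(1) in auto)
    then have "norm (deriv (f \<circ> ?F) 0) = norm (deriv f p) * \<bar>1 - (norm p)\<^sup>2\<bar>"
      unfolding F(4,5) by (simp only: norm_mult norm_of_real)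
    moreover have "(norm p)\<^sup>2 < 1" using p(1) by (simp add: abs_square_less_1)
    ultimately show "norm (deriv (f \<circ> ?F) 0) > 1 - \<epsilon>" using p(3) by simp
    show "\<forall>s. Re s > 0 \<longrightarrow> norm s < 1 \<longrightarrow>
       ereal (norm (deriv (f \<circ> ?F) (u * s\<^sup>2)) * slit_radius s) \<le> bloch_seminorm (f \<circ> B)"
    proof (intro allI impI)
      fix s :: complex assume s: "Re s > 0" "norm s < 1"
      define w where "w = u * s\<^sup>2"
      have w: "w \<in> slit_disc u" unfolding w_def by (rule mem_slit_disc[OF u s])
      define z where "z = G w"
      have z: "z \<in> ball 0 1" using G'(3) w unfolding z_def by blast
      have bz: "?b z = ?F w" using G'(4)[OF w] z_def by simp
      have Fw: "?F w \<in> ball 0 1" using F(3) G'(5) w by blast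
      have db: "?b field_differentiable at z" by (rule diff[OF B_holo z])
      have df: "f field_differentiable at (?b z)" unfolding bz by (rule diff[OF f(1) Fw])
      have fb: "(f \<circ> ?b) field_differentiable at z" by (rule field_differentiable_compose[OF db df])
      have dG: "G field_differentiable at w" by (rule holomorphic_on_imp_differentiable_at[OF G'(2,1) w])
      have "deriv (f \<circ> ?F) w = deriv ((f \<circ> ?b) \<circ> G) w"
        by (rule deriv_cong_ev) (use G'(1,4) w in \<open>auto simp: eventually_nhds intro!: exI[of _ "slit_disc u"]\<close>)
      also have "\<dots> = deriv (f \<circ> ?b) z * deriv G w"
        using deriv_chain[OF dG fb[unfolded z_def]] unfolding z_def .
      also have "deriv (f \<circ> ?b) z = deriv (f \<circ> B) z"
        by (rule deriv_cong_ev) (use z B_eq in \<open>auto simp: eventually_nhds intro!: exI[of _ "ball 0 1"]\<close>)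
      finally have "norm (deriv (f \<circ> ?F) w) * slit_radius s = norm (deriv (f \<circ> B) z) * (norm (deriv G w) * slit_radius s)"
        by (simp only: norm_mult mult.assoc)
      also have "\<dots> \<le> norm (deriv (f \<circ> B) z) * (1 - (norm z)\<^sup>2)"
        using Schwarz_Pick_slit_disc[OF u s G'(2,3,1)] unfolding z_def w_def by (intro mult_left_mono) auto
      finally have "ereal (norm (deriv (f \<circ> ?F) w) * slit_radius s) \<le> ereal (norm (deriv (f \<circ> B) z) * (1 - (norm z)\<^sup>2))"
        by simp
      also have "\<dots> \<le> bloch_seminorm (f \<circ> B)"
        unfolding bloch_seminorm_def by (rule SUP_upper[OF z])
      finally show "ereal (norm (deriv (f \<circ> ?F) (u * s\<^sup>2)) * slit_radius s) \<le> bloch_seminorm (f \<circ> B)"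
        unfolding w_def .
    qed
  qed
qed

text \<open>The maximum principle applies because on a circle about 0 the conformal radius is the
  modulus of a holomorphic function.\<close>

lemma deriv_at_0_le_slit_bound:
  assumes h: "h holomorphic_on ball 0 1" and u: "norm u = 1"
    and le: "\<And>s. Re s > 0 \<Longrightarrow> norm s < 1 \<Longrightarrow> norm (deriv h (u * s\<^sup>2)) * slit_radius s \<le> m"
  shows "norm (deriv h 0) \<le> 2 * m"
proof -
  \<comment> \<open>On |w| = 1/2 with w = s^2 one has |1 + 2 w| = 4 |s| Re s and 1 - |s|^2 = 1/2, so
    |K| is exactly twice |h'| times the conformal radius, while K(0) = h'(0).\<close>
  define K where "K = (\<lambda>w. deriv h (u * w) * (1 + 2 * w) / (1 + w))"
  have h': "deriv h holomorphic_on ball 0 1" by (intro holomorphic_deriv h) auto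
  have "(\<lambda>w. deriv h (u * w)) holomorphic_on ball 0 1"
    by (rule holomorphic_on_compose_gen[OF _ h', of "\<lambda>w. u * w", unfolded o_def])
      (use u in \<open>auto intro!: holomorphic_intros simp: norm_mult\<close>)
  moreover have nz: "1 + w \<noteq> 0" if "w \<in> ball 0 1" for w :: complex
    using that by (auto simp: add_eq_0_iff)
  ultimately have K: "K holomorphic_on ball 0 1"
    unfolding K_def by (intro holomorphic_intros) auto
  have r: "slit_radius 0 = 0" unfolding slit_radius_def by simp
  have "norm (deriv h (u * (1/2)\<^sup>2)) * slit_radius (1/2) \<le> m" by (rule le) auto
  moreover have "slit_radius (1/2) \<ge> 0" unfolding slit_radius_def by (simp add: power2_eq_square)
  ultimately have m: "m \<ge> 0" by (meson mult_nonneg_nonneg norm_ge_zero order_trans)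
  have bound: "norm (K w) \<le> 2 * m" if w: "norm w = 1 / 2" for w
  proof -
    define s where "s = csqrt w"
    have s2: "s\<^sup>2 = w" unfolding s_def by simp
    have ns: "(norm s)\<^sup>2 = 1 / 2" using w s2 by (metis norm_power)
    have "s * cnj s = of_real (1 / 2)" unfolding complex_norm_square[symmetric] ns ..
    moreover have "2 * s * (cnj s + s) = 2 * (s * cnj s) + 2 * s\<^sup>2"
      by (simp add: algebra_simps power2_eq_square)
    ultimately have "2 * s * (cnj s + s) = 2 * of_real (1 / 2) + 2 * s\<^sup>2" by (simp only:)
    then have "1 + 2 * w = 2 * s * (cnj s + s)" using s2 by simp
    also have "cnj s + s = 2 * of_real (Re s)" by (simp add: complex_eq_iff)
    finally have eq: "norm (1 + 2 * w) = 4 * norm s * \<bar>Re s\<bar>" by (simp add: norm_mult)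
    have Re: "Re s \<ge> 0" using csqrt_principal[of w] unfolding s_def by auto
    show ?thesis
    proof (cases "Re s = 0")
      \<comment> \<open>Here w = -1/2 lies on the slit, where the hypothesis says nothing; but K
        vanishes there and m >= 0.\<close>
      case True
      then show ?thesis using eq m unfolding K_def by (simp add: norm_mult norm_divide)
    next
      case False
      have "slit_radius s = 2 * norm s * Re s / norm (1 + w)" unfolding slit_radius_def ns s2 by simp
      moreover have "norm (K w) = norm (deriv h (u * w)) * (4 * norm s * Re s) / norm (1 + w)"
        unfolding K_def norm_mult norm_divide eq using Re by simp
      ultimately have "norm (K w) = 2 * (norm (deriv h (u * s\<^sup>2)) * slit_radius s)" unfolding s2 by simp
      also have "\<dots> \<le> 2 * m"
      proof -
        have "(norm s)\<^sup>2 < 1" using ns by simp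
        then have "norm s < 1" by (simp add: abs_square_less_1)
        then show ?thesis using le[of s] Re False by simp
      qed
      finally show ?thesis .
    qed
  qed
  have "norm (K 0) \<le> 2 * m"
  proof (rule maximum_modulus_frontier[of K "cball 0 (1/2)"])
    have sub: "cball 0 (1/2) \<subseteq> ball (0::complex) 1" by auto
    show "K holomorphic_on interior (cball 0 (1/2))"
      using sub interior_subset by (intro holomorphic_on_subset[OF K]) blast
    show "continuous_on (closure (cball 0 (1/2))) K"
      using sub by (intro holomorphic_on_imp_continuous_on holomorphic_on_subset[OF K]) simp
    show "norm (K z) \<le> 2 * m" if "z \<in> frontier (cball 0 (1/2))" for z
      using that by (intro bound) simp
  qed auto
  then show ?thesis unfolding K_def by simp
qed

text \<open>The hypothesis \<open>le\<close> is multiplied over the three points and combined with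
  the lower bound for the product of derivatives.\<close>

lemma convex_slit_bound:
  assumes h: "h holomorphic_on ball 0 1" "inj_on h (ball 0 1)" "convex (h ` ball 0 1)" and u: "norm u = 1"
    and le: "\<And>s. Re s > 0 \<Longrightarrow> norm s < 1 \<Longrightarrow> norm (deriv h (u * s\<^sup>2)) * slit_radius s \<le> m"
    and r: "0 < r" "r < 1"
  shows "norm (deriv h 0) ^ 3 * (4 * r * (1 - r)) ^ 3 \<le> 4 * (1 + r ^ 3) ^ 3 * m ^ 3"
proof -
  \<comment> \<open>A sixth root of unity: 1, \<open>e\<close> and \<open>cnj e\<close> lie in the
    right half-plane and their squares are the three cube roots of unity.\<close>
  define e where "e = Complex (1/2) (sqrt 3 / 2)"
  define \<rho> where "\<rho> = sqrt r"
  have \<rho>: "0 < \<rho>" "\<rho> < 1" "\<rho>\<^sup>2 = r" unfolding \<rho>_def using r by auto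
  have ne: "norm e = 1" unfolding e_def by (simp add: cmod_def power_divide)
  have e2: "e\<^sup>2 = Complex (-1/2) (sqrt 3 / 2)"
    unfolding e_def by (simp add: complex_eq_iff power2_eq_square)
  have e3: "e ^ 3 = -1"
    unfolding power3_eq_cube using e2 unfolding power2_eq_square by (simp add: e_def complex_eq_iff)
  have "(e\<^sup>2) ^ 3 = (e ^ 3)\<^sup>2" by (simp flip: power_mult)
  then have w: "(e\<^sup>2) ^ 3 = 1" "e\<^sup>2 \<noteq> 1" unfolding e3 e2 by (simp_all add: complex_eq_iff)
  have c2: "(cnj e)\<^sup>2 = (e\<^sup>2)\<^sup>2"
    unfolding e2 by (simp add: e_def complex_eq_iff power2_eq_square)
  define D0 D1 D2 where "D0 = norm (deriv h (of_real r * u))"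
    and "D1 = norm (deriv h (of_real r * (e\<^sup>2 * u)))" and "D2 = norm (deriv h (of_real r * ((e\<^sup>2)\<^sup>2 * u)))"
  have prod: "norm (deriv h 0) ^ 3 \<le> D0 * D1 * D2 * (1 + r ^ 3)\<^sup>2"
    unfolding D0_def D1_def D2_def by (rule convex_univalent_deriv_product[OF h w u]) (use r in auto)
  \<comment> \<open>The conformal radii at r u and at each of the two other points, which are mirror
    images in the axis of the slit.\<close>
  define R0 R1 where "R0 = 4 * r * (1 - r) / (1 + r)" and "R1 = 2 * r * (1 - r) / sqrt (1 - r + r\<^sup>2)"
  have q: "1 - r + r\<^sup>2 > 0" using r by (simp add: add_pos_pos)
  have sq: "(of_real \<rho> * s)\<^sup>2 = of_real r * s\<^sup>2" for s :: complex
    by (simp add: power_mult_distrib \<rho>(3) flip: of_real_power)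
  have n2: "norm (1 + of_real r * s) = sqrt (1 - r + r\<^sup>2)" if "norm s = 1" "Re s = -1/2" for s
  proof -
    have Im: "(Im s)\<^sup>2 = 3 / 4" using that cmod_power2[of s] by (simp add: power2_eq_square)
    have "(1 + r * Re s)\<^sup>2 + (r * Im s)\<^sup>2 = 1 - r + r\<^sup>2"
      unfolding power_mult_distrib Im that(2) by (simp add: power2_eq_square field_simps)
    then show ?thesis by (simp add: cmod_def)
  qed
  have R0: "slit_radius (of_real \<rho> * 1) = R0"
  proof -
    have "norm (of_real (1 + r) :: complex) = 1 + r" unfolding norm_of_real using r by simp
    then have n: "norm (1 + of_real r :: complex) = 1 + r" by simp
    have "slit_radius (of_real \<rho> * 1) = 4 * (\<rho> * \<rho>) * (1 - \<rho>\<^sup>2) / norm (1 + of_real r :: complex)"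
      unfolding slit_radius_def sq using \<rho>(1) by (simp add: norm_mult mult.assoc)
    then show ?thesis unfolding n R0_def using \<rho>(3) by (simp add: power2_eq_square)
  qed
  have R1: "slit_radius (of_real \<rho> * s) = R1" if "norm s = 1" "Re s = 1/2" "Re (s\<^sup>2) = -1/2" for s
  proof -
    have "norm (s\<^sup>2) = 1" using that by (simp add: norm_power)
    note n = n2[OF this that(3)]
    have "slit_radius (of_real \<rho> * s) = 4 * (\<rho> * \<rho>) * Re s * (1 - \<rho>\<^sup>2) / norm (1 + of_real r * s\<^sup>2)"
      unfolding slit_radius_def sq using \<rho>(1) that(1) by (simp add: norm_mult mult.assoc)
    then show ?thesis unfolding n R1_def that(2) using \<rho>(3) by (simp add: power2_eq_square)
  qed
  have 0: "D0 * R0 \<le> m"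
    using le[of "of_real \<rho> * 1"] \<rho> unfolding R0 sq D0_def by (simp add: norm_mult mult.commute)
  have 1: "D1 * R1 \<le> m"
  proof -
    have "slit_radius (of_real \<rho> * e) = R1" by (rule R1) (use ne e2 in \<open>auto simp: e_def\<close>)
    then show ?thesis using le[of "of_real \<rho> * e"] \<rho> ne unfolding sq D1_def
      by (simp add: norm_mult mult_ac e_def)
  qed
  have 2: "D2 * R1 \<le> m"
  proof -
    have "slit_radius (of_real \<rho> * cnj e) = R1"
      by (rule R1) (use ne e2 in \<open>auto simp: e_def simp flip: complex_cnj_power\<close>)
    then show ?thesis using le[of "of_real \<rho> * cnj e"] \<rho> ne unfolding sq D2_def c2
      by (simp add: norm_mult mult_ac e_def)
  qed
  have R_nonneg: "R0 \<ge> 0" "R1 \<ge> 0" unfolding R0_def R1_def using r q by auto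
  have D_nonneg: "D0 \<ge> 0" "D1 \<ge> 0" "D2 \<ge> 0" unfolding D0_def D1_def D2_def by auto
  have "m \<ge> 0" using 0 R_nonneg D_nonneg by (meson mult_nonneg_nonneg order_trans)
  then have "(D0 * R0) * (D1 * R1) * (D2 * R1) \<le> m * m * m"
    using 0 1 2 R_nonneg D_nonneg by (intro mult_mono) auto
  then have main: "D0 * D1 * D2 * (R0 * R1\<^sup>2) \<le> m ^ 3"
    by (simp add: power2_eq_square power3_eq_cube mult_ac)
  have "R0 * R1\<^sup>2 = (4 * r * (1 - r)) ^ 3 / (4 * ((1 + r) * (1 - r + r\<^sup>2)))"
    unfolding R0_def R1_def using q by (simp add: power_divide power2_eq_square power3_eq_cube)
  also have "(1 + r) * (1 - r + r\<^sup>2) = 1 + r ^ 3"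
    by (simp add: power2_eq_square power3_eq_cube algebra_simps)
  \<comment> \<open>The denominators 1 + r and |1 + r omega|^2 multiply to 1 + r^3, the same
    quantity as in the derivative bound.\<close>
  finally have RR: "R0 * R1\<^sup>2 = (4 * r * (1 - r)) ^ 3 / (4 * (1 + r ^ 3))" .
  have c: "1 + r ^ 3 > 0" using r by (simp add: add_pos_pos)
  have "norm (deriv h 0) ^ 3 * (4 * r * (1 - r)) ^ 3 = norm (deriv h 0) ^ 3 * (R0 * R1\<^sup>2) * (4 * (1 + r ^ 3))"
    unfolding RR using c by simp
  also have "\<dots> \<le> (D0 * D1 * D2 * (1 + r ^ 3)\<^sup>2) * (R0 * R1\<^sup>2) * (4 * (1 + r ^ 3))"
    using prod R_nonneg c by (intro mult_right_mono) auto
  also have "\<dots> = (D0 * D1 * D2 * (R0 * R1\<^sup>2)) * (4 * (1 + r ^ 3) ^ 3)"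
    by (simp add: power2_eq_square power3_eq_cube mult_ac)
  also have "\<dots> \<le> m ^ 3 * (4 * (1 + r ^ 3) ^ 3)"
    using main c by (intro mult_right_mono) auto
  finally show ?thesis by (simp add: mult_ac)
qed

theorem theorem3:
  "\<exists>r0::real. 0.695356 \<le> r0 \<and> r0 < 0.695357 \<and>
     0.301098 \<le> sqrt 3 * r0 / 4 \<and> sqrt 3 * r0 / 4 < 0.301099 \<and>
     0.546131 \<le> pi * r0 / 4 \<and> pi * r0 / 4 < 0.546132 \<and>
     (\<forall>(f :: complex \<Rightarrow> complex) (B :: complex \<Rightarrow> complex).
        f holomorphic_on ball 0 1 \<longrightarrow> deriv f 0 = 1 \<longrightarrow> finite_blaschke_product B \<longrightarrow>
          bloch_seminorm (f \<circ> B) \<ge> ereal (sqrt 3 * r0 / 4) \<and>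
          (convex_univalent f \<longrightarrow> bloch_seminorm (f \<circ> B) \<ge> ereal (pi * r0 / 4)))"
proof (intro exI[of _ "0.6953565"] conjI allI impI)
  \<comment> \<open>The witness 0.6953565 is the midpoint of the interval prescribed for
    \<open>r0\<close>; the bounds proved below exceed both resulting constants.\<close>
  have s3: "(1.7320508::real) \<le> sqrt 3" "sqrt 3 \<le> (1.7320509::real)"
    by (rule real_le_rsqrt, simp add: power2_eq_square) (rule real_le_lsqrt, simp_all add: power2_eq_square)
  then show "0.301098 \<le> sqrt 3 * 0.6953565 / 4" and s3': "sqrt 3 * 0.6953565 / 4 < 0.301099" by simp_all
  show "0.546131 \<le> pi * 0.6953565 / 4" and pi': "pi * 0.6953565 / 4 < 0.546132"
    using pi_approx by simp_all
  fix f B :: "complex \<Rightarrow> complex"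
  assume f: "f holomorphic_on ball 0 1" "deriv f 0 = 1" and B: "finite_blaschke_product B"
  \<comment> \<open>A loss of 0.02 is affordable: 0.98 / 2 = 0.49 exceeds 0.302, and 0.98 times
    about 0.5716 exceeds 0.5462.\<close>
  have small: "(0::real) < 0.02" by simp
  obtain p u where p: "norm p < 1" and u: "norm u = 1"
    and h0: "norm (deriv (f \<circ> Moebius_function 0 (- p)) 0) > 1 - 0.02"
    and le: "\<forall>s. Re s > 0 \<longrightarrow> norm s < 1 \<longrightarrow>
       ereal (norm (deriv (f \<circ> Moebius_function 0 (- p)) (u * s\<^sup>2)) * slit_radius s) \<le> bloch_seminorm (f \<circ> B)"
    using bloch_seminorm_blaschke_lower_bound[OF f B small] .
  let ?h = "f \<circ> Moebius_function 0 (- p)"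
  note F = Moebius_disc_automorphism[OF p]
  have h: "?h holomorphic_on ball 0 1"
    by (rule holomorphic_on_compose_gen[OF F(1) f(1)]) (use F(3) in simp)
  have below: "norm (deriv ?h (u * s\<^sup>2)) * slit_radius s \<le> m"
    if "bloch_seminorm (f \<circ> B) < ereal m" "Re s > 0" "norm s < 1" for m s
  proof -
    have "ereal (norm (deriv ?h (u * s\<^sup>2)) * slit_radius s) \<le> bloch_seminorm (f \<circ> B)"
      by (rule le[rule_format, OF that(2,3)])
    from order_le_less_trans[OF this that(1)] show ?thesis by simp
  qed
  define c where "c = sqrt 3 * 0.6953565 / 4"
  show "ereal (sqrt 3 * 0.6953565 / 4) \<le> bloch_seminorm (f \<circ> B)"
  proof (rule ccontr)
    assume "\<not> ?thesis"
    then have lt: "bloch_seminorm (f \<circ> B) < ereal (sqrt 3 * 0.6953565 / 4)" by (simp only: not_le)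
    have "norm (deriv ?h 0) \<le> 2 * (sqrt 3 * 0.6953565 / 4)"
      by (rule deriv_at_0_le_slit_bound[OF h u below[OF lt]])
    then have "norm (deriv ?h 0) \<le> 2 * c" unfolding c_def .
    then show False using h0 s3' unfolding c_def[symmetric] by simp
  qed
  assume conv: "convex_univalent f"
  define m where "m = pi * 0.6953565 / 4"
  show "ereal (pi * 0.6953565 / 4) \<le> bloch_seminorm (f \<circ> B)"
  proof (rule ccontr)
    assume "\<not> ?thesis"
    then have lt: "bloch_seminorm (f \<circ> B) < ereal m" unfolding m_def by (simp only: not_le)
    have inj: "inj_on ?h (ball 0 1)"
      by (rule comp_inj_on[OF F(2)]) (use conv F(3) in \<open>simp add: convex_univalent_def\<close>)
    have "?h ` ball 0 1 = f ` ball 0 1" unfolding image_comp[symmetric] F(3) ..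
    then have convex: "convex (?h ` ball 0 1)" using conv unfolding convex_univalent_def by simp
    \<comment> \<open>The radius 0.45 is close to the maximum of r (1 - r) / (1 + r^3). Working with
      cubes keeps the final comparison rational.\<close>
    have "(0.98::real) ^ 3 \<le> norm (deriv ?h 0) ^ 3" using h0 by (intro power_mono) auto
    then have "(0.98::real) ^ 3 * (4 * 0.45 * (1 - 0.45)) ^ 3 \<le> norm (deriv ?h 0) ^ 3 * (4 * 0.45 * (1 - 0.45)) ^ 3"
      by (rule mult_right_mono) simp
    also have "\<dots> \<le> 4 * (1 + 0.45 ^ 3) ^ 3 * m ^ 3"
      by (rule convex_slit_bound[OF h inj convex u below[OF lt]]) simp_all
    also have "m ^ 3 \<le> 0.546132 ^ 3"
      using pi' unfolding m_def by (intro power_mono) auto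
    then have "4 * (1 + 0.45 ^ 3) ^ 3 * m ^ 3 \<le> 4 * (1 + 0.45 ^ 3) ^ 3 * 0.546132 ^ 3"
      by (rule mult_left_mono) simp
    finally show False by (simp add: power3_eq_cube)
  qed
qed simp_all

end
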